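(* Let $\Pi$ be a polar space of rank $n\ge3$ and let $k,l,m$ be natural numbers with $0<m\le k$, $l\le n$ and $3\le l-m\le n-k$. Let $f$ be an embedding of $PJ(l,m)$ in $\Gamma_k(\Pi)$ which maps every top of $PJ(l,m)$ to an independent subset of $\mathfrak G_k(\Pi)$ contained in a top of $\mathcal G_k(\Pi)$. Then there exists a $(k-m-1)$-dimensional singular subspace $N$ such that the image of $f$ is contained in $[N\rangle_k$, and there exists an $l$-frame $\mathcal B$ of the polar space $[N\rangle_{k-m}$ such that every element of the image of $f$ is spanned (as a subspace of $\Pi$) by elements of $\mathcal B$.
   Context: Polar space $\Pi$ of rank $n$: partial linear space with lines of $\ge3$ points, no point collinear with all others, each point collinear with one or all points of a line, finite flags of singular subspaces; maximal singular subspaces are $(n-1)$-dimensional projective spaces. $\mathcal G_j(\Pi)$: $j$-dimensional singular subspaces ($\dim\emptyset=-1$). For $j\le n-2$, $S,U\in\mathcal G_j(\Pi)$ are adjacent if $\dim(S\cap U)=j-1$ and every point of $S$ is collinear with every point of $U$; this gives $\Gamma_j(\Pi)$. $[S,U]_j=\{X\in\mathcal G_j(\Pi):S\subset X\subset U\}$, $\langle U]_j=\{X\in\mathcal G_j(\Pi):X\subset U\}$, $[S\rangle_j=\{X\in\mathcal G_j(\Pi):S\subset X\}$. The Grassmann space $\mathfrak G_k(\Pi)$ has points $\mathcal G_k(\Pi)$ and lines $[S,U]_k$, $S\in\mathcal G_{k-1}(\Pi)$, $U\in\mathcal G_{k+1}(\Pi)$, $S\subset U$. A top of $\mathcal G_k(\Pi)$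 is $\langle U]_k$ with $U\in\mathcal G_{k+1}(\Pi)$. A subset $Z$ of a partial linear space is independent if the subspace it spans is not spanned by a proper subset. For a $(k-m-1)$-dimensional singular subspace $N$, $[N\rangle_{k-m}$ with lines $[S,U]_{k-m}$ ($N\subset S$) is a polar space of rank $n-k+m$; an $l$-frame of it is a set of $2l$ distinct points of it each non-collinear (in it) with exactly one other point of the set. Polar Johnson graph $PJ(l,m)$: with $J=\{\pm1,\dots,\pm l\}$, singular subsets are those not containing both $j$ and $-j$; vertices are singular $(m+1)$-subsets, adjacent when they share $m$ elements and (if $m\le l-2$) their union is singular. A top of $PJ(l,m)$ is the set of all $(m+1)$-subsets of a singular $(m+2)$-subset of $J$. An embedding is an injective vertex map such that two vertices are adjacent iff their images are. *)

theory Defs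
  imports Main
begin

section \<open>Point-line geometries\<close>

record 'p geometry =
  points :: "'p set"
  lines :: "'p set set"

definition partial_linear_space :: "'p geometry \<Rightarrow> bool" where
  "partial_linear_space G \<longleftrightarrow>
     (\<forall>L\<in>lines G. L \<subseteq> points G \<and> (\<exists>p\<in>L. \<exists>q\<in>L. p \<noteq> q)) \<and>
     (\<forall>L\<in>lines G. \<forall>M\<in>lines G. \<forall>p q. p \<noteq> q \<and> {p, q} \<subseteq> L \<and> {p, q} \<subseteq> M \<longrightarrow> L = M)"

text \<open>Collinearity is taken to be reflexive, so that a statement such as ``every point of
  \<open>S\<close> is collinear with every point of \<open>U\<close>'' makes sense when \<open>S\<close> and \<open>U\<close> meet.\<close>

definition collinear :: "'p geometry \<Rightarrow> 'p \<Rightarrow> 'p \<Rightarrow> bool" where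
  "collinear G p q \<longleftrightarrow> p = q \<or> (\<exists>L\<in>lines G. p \<in> L \<and> q \<in> L)"

definition is_subspace :: "'p geometry \<Rightarrow> 'p set \<Rightarrow> bool" where
  "is_subspace G X \<longleftrightarrow> X \<subseteq> points G \<and>
     (\<forall>p\<in>X. \<forall>q\<in>X. \<forall>L\<in>lines G. p \<noteq> q \<and> p \<in> L \<and> q \<in> L \<longrightarrow> L \<subseteq> X)"

definition singular_subspace :: "'p geometry \<Rightarrow> 'p set \<Rightarrow> bool" where
  "singular_subspace G X \<longleftrightarrow> is_subspace G X \<and> (\<forall>p\<in>X. \<forall>q\<in>X. collinear G p q)"

definition maximal_singular_subspace :: "'p geometry \<Rightarrow> 'p set \<Rightarrow> bool" where
  "maximal_singular_subspace G X \<longleftrightarrow> singular_subspace G X \<and>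
     (\<forall>Y. singular_subspace G Y \<and> X \<subseteq> Y \<longrightarrow> Y = X)"

definition spanned :: "'p geometry \<Rightarrow> 'p set \<Rightarrow> 'p set" where
  "spanned G Z = \<Inter>{X. is_subspace G X \<and> Z \<subseteq> X}"

definition independent_set :: "'p geometry \<Rightarrow> 'p set \<Rightarrow> bool" where
  "independent_set G Z \<longleftrightarrow> Z \<subseteq> points G \<and> (\<forall>Y. Y \<subset> Z \<longrightarrow> spanned G Y \<noteq> spanned G Z)"

text \<open>A subspace has dimension \<open>d\<close> if it has a base (an independent spanning subset) of
  cardinality \<open>d + 1\<close>. Below this is applied only to singular subspaces of polar spaces; these
  are projective spaces, so any two of their bases have the same cardinality. The dimension is
  an integer because the empty subspace has dimension \<open>-1\<close>.\<close>

definition has_dim :: "'p geometry \<Rightarrow> 'p set \<Rightarrow> int \<Rightarrow> bool" where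
  "has_dim G X d \<longleftrightarrow>
     (\<exists>B. finite B \<and> independent_set G B \<and> spanned G B = X \<and> int (card B) = d + 1)"

definition restriction :: "'p geometry \<Rightarrow> 'p set \<Rightarrow> 'p geometry" where
  "restriction G X = \<lparr>points = X, lines = {L \<in> lines G. L \<subseteq> X}\<rparr>"

text \<open>The last conjunct is the Veblen--Young axiom: two lines which both meet the sides of a
  triangle through the vertex \<open>p\<close>, off \<open>p\<close>, have a common point.\<close>

definition projective_space :: "'p geometry \<Rightarrow> bool" where
  "projective_space G \<longleftrightarrow> partial_linear_space G \<and>
     (\<forall>p\<in>points G. \<forall>q\<in>points G. collinear G p q) \<and>
     (\<forall>L\<in>lines G. \<exists>p q r. {p, q, r} \<subseteq> L \<and> p \<noteq> q \<and> p \<noteq> r \<and> q \<noteq> r) \<and>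
     (\<forall>L\<in>lines G. \<forall>M\<in>lines G. \<forall>A\<in>lines G. \<forall>B\<in>lines G. \<forall>p.
        L \<noteq> M \<and> p \<in> L \<and> p \<in> M \<and> p \<notin> A \<and> p \<notin> B \<and>
        A \<inter> L \<noteq> {} \<and> A \<inter> M \<noteq> {} \<and> B \<inter> L \<noteq> {} \<and> B \<inter> M \<noteq> {} \<longrightarrow> A \<inter> B \<noteq> {})"


section \<open>Polar spaces\<close>

definition polar_space :: "'p geometry \<Rightarrow> bool" where
  "polar_space G \<longleftrightarrow> partial_linear_space G \<and>
     (\<forall>L\<in>lines G. \<exists>p q r. {p, q, r} \<subseteq> L \<and> p \<noteq> q \<and> p \<noteq> r \<and> q \<noteq> r) \<and>
     \<not> (\<exists>p\<in>points G. \<forall>q\<in>points G. q \<noteq> p \<longrightarrow> collinear G p q) \<and>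
     (\<forall>p\<in>points G. \<forall>L\<in>lines G.
        (\<exists>!q. q \<in> L \<and> collinear G p q) \<or> (\<forall>q\<in>L. collinear G p q)) \<and>
     (\<forall>F. subset.chain {X. singular_subspace G X} F \<longrightarrow> finite F)"

definition polar_space_of_rank :: "'p geometry \<Rightarrow> nat \<Rightarrow> bool" where
  "polar_space_of_rank G n \<longleftrightarrow> polar_space G \<and>
     (\<forall>M. maximal_singular_subspace G M \<longrightarrow>
        projective_space (restriction G M) \<and> has_dim G M (int n - 1))"

definition frame :: "'p geometry \<Rightarrow> nat \<Rightarrow> 'p set \<Rightarrow> bool" where
  "frame G l B \<longleftrightarrow> B \<subseteq> points G \<and> finite B \<and> card B = 2 * l \<and>
     (\<forall>p\<in>B. \<exists>!q. q \<in> B \<and> q \<noteq> p \<and> \<not> collinear G p q)"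


section \<open>Polar Grassmannians\<close>

definition grassmannian :: "'p geometry \<Rightarrow> int \<Rightarrow> 'p set set" where
  "grassmannian G j = {X. singular_subspace G X \<and> has_dim G X j}"

definition subspaces_between :: "'p geometry \<Rightarrow> int \<Rightarrow> 'p set \<Rightarrow> 'p set \<Rightarrow> 'p set set" where
  "subspaces_between G j S U = {X \<in> grassmannian G j. S \<subseteq> X \<and> X \<subseteq> U}"

definition subspaces_below :: "'p geometry \<Rightarrow> int \<Rightarrow> 'p set \<Rightarrow> 'p set set" where
  "subspaces_below G j U = {X \<in> grassmannian G j. X \<subseteq> U}"

definition subspaces_above :: "'p geometry \<Rightarrow> int \<Rightarrow> 'p set \<Rightarrow> 'p set set" where
  "subspaces_above G j S = {X \<in> grassmannian G j. S \<subseteq> X}"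

text \<open>The adjacency relation of \<open>\<Gamma>\<^sub>j\<close> and the lines of the Grassmann space are those for
  \<open>j \<le> n - 2\<close>, where \<open>n\<close> is the rank (for \<open>j = n - 1\<close> one uses different ones).\<close>

definition grassmann_adjacent :: "'p geometry \<Rightarrow> int \<Rightarrow> 'p set \<Rightarrow> 'p set \<Rightarrow> bool" where
  "grassmann_adjacent G j S U \<longleftrightarrow> S \<in> grassmannian G j \<and> U \<in> grassmannian G j \<and>
     has_dim G (S \<inter> U) (j - 1) \<and> (\<forall>p\<in>S. \<forall>q\<in>U. collinear G p q)"

definition grassmann_space :: "'p geometry \<Rightarrow> int \<Rightarrow> 'p set geometry" where
  "grassmann_space G j =
     \<lparr>points = grassmannian G j,
      lines = {subspaces_between G j S U | S U.
        S \<in> grassmannian G (j - 1) \<and> U \<in> grassmannian G (j + 1) \<and> S \<subseteq> U}\<rparr>"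

definition grassmann_tops :: "'p geometry \<Rightarrow> int \<Rightarrow> 'p set set set" where
  "grassmann_tops G j = {subspaces_below G j U | U. U \<in> grassmannian G (j + 1)}"

text \<open>The points and lines of the Grassmann space above \<open>N\<close>; for \<open>N\<close> of dimension \<open>j - 1\<close>
  this is the polar space formed by the \<open>j\<close>-dimensional singular subspaces through \<open>N\<close>.\<close>

definition residue :: "'p geometry \<Rightarrow> int \<Rightarrow> 'p set \<Rightarrow> 'p set geometry" where
  "residue G j N =
     \<lparr>points = subspaces_above G j N,
      lines = {subspaces_between G j S U | S U.
        S \<in> grassmannian G (j - 1) \<and> U \<in> grassmannian G (j + 1) \<and> N \<subseteq> S \<and> S \<subseteq> U}\<rparr>"


section \<open>Polar Johnson graphs\<close>

definition signed_indices :: "nat \<Rightarrow> int set" where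
  "signed_indices l = {j. j \<noteq> 0 \<and> \<bar>j\<bar> \<le> int l}"

definition singular_subset :: "nat \<Rightarrow> int set \<Rightarrow> bool" where
  "singular_subset l X \<longleftrightarrow> X \<subseteq> signed_indices l \<and> \<not> (\<exists>j. j \<in> X \<and> - j \<in> X)"

definition PJ_vertices :: "nat \<Rightarrow> nat \<Rightarrow> int set set" where
  "PJ_vertices l m = {X. singular_subset l X \<and> card X = m + 1}"

definition PJ_adjacent :: "nat \<Rightarrow> nat \<Rightarrow> int set \<Rightarrow> int set \<Rightarrow> bool" where
  "PJ_adjacent l m X Y \<longleftrightarrow> X \<in> PJ_vertices l m \<and> Y \<in> PJ_vertices l m \<and>
     card (X \<inter> Y) = m \<and> (int m \<le> int l - 2 \<longrightarrow> singular_subset l (X \<union> Y))"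

definition PJ_tops :: "nat \<Rightarrow> nat \<Rightarrow> int set set set" where
  "PJ_tops l m =
     {{X. X \<subseteq> Y \<and> card X = m + 1} | Y. singular_subset l Y \<and> card Y = m + 2}"

definition graph_embedding ::
  "'v set \<Rightarrow> ('v \<Rightarrow> 'v \<Rightarrow> bool) \<Rightarrow> 'w set \<Rightarrow> ('w \<Rightarrow> 'w \<Rightarrow> bool) \<Rightarrow> ('v \<Rightarrow> 'w) \<Rightarrow> bool" where
  "graph_embedding V E W F f \<longleftrightarrow> f ` V \<subseteq> W \<and> inj_on f V \<and>
     (\<forall>x\<in>V. \<forall>y\<in>V. E x y \<longleftrightarrow> F (f x) (f y))"

end

(* Let Y be a singular (m+2)-subset of J. The images of the (m+1)-subsets of Y are m + 2 hyperplanes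
   of one (k+1)-dimensional singular subspace U, and they are independent as points of the dual of U,
   so any c of them meet in dimension k + 1 - c. For a singular set A let W A be the intersection of
   all f X with X containing A. A triangle argument shows f (Z + i) \<inter> f (Z + j) \<subseteq> f (Z + t) whenever
   Z + i + j + t is singular; as the singular (m+2)-sets containing A are connected under exchanging
   one element, W A is already the intersection of the f X with A \<subseteq> X \<subseteq> Y, for any Y containing A.
   Hence dim (W A) = k - m - 1 + |A|. Now N = W {} and the frame consists of the W {x}. *)
theory Submission
  imports Defs
begin

section \<open>Dimension in singular subspaces\<close>

text \<open>The hypotheses on tops are local: they speak of one singular subspace \<open>U\<close>
  at a time, while images of vertices without a common top are only known to be adjacent or not.
  Independence lives in the Grassmann space, whose lines inside \<open>U\<close> are the pencils of
  hyperplanes through a subspace of codimension two; turning it into dimensions of intersections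
  needs bases and exchange in projective spaces. The gap between tops is closed by the triangle
  argument, whose contradiction comes from the embedding reflecting adjacency. Opposite indices
  never share a singular set, so tops say nothing about \<open>W {x}\<close> and
  \<open>W {- x}\<close>. These fail to be orthogonal because the vertices obtained from one
  \<open>m\<close>-set \<open>Z\<close> by adding \<open>x\<close> and \<open>- x\<close> are not
  adjacent, although everything else that adjacency of their images requires is forced by
  dimension.\<close>

lemma is_subspaceI:
  assumes "X \<subseteq> points G"
    and "\<And>p q L r. p \<in> X \<Longrightarrow> q \<in> X \<Longrightarrow> p \<noteq> q \<Longrightarrow> L \<in> lines G \<Longrightarrow> p \<in> L \<Longrightarrow> q \<in> L \<Longrightarrow> r \<in> L \<Longrightarrow> r \<in> X"
  shows "is_subspace G X"
  using assms unfolding is_subspace_def by blast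

lemma is_subspaceD:
  "is_subspace G X \<Longrightarrow> p \<in> X \<Longrightarrow> q \<in> X \<Longrightarrow> p \<noteq> q \<Longrightarrow> L \<in> lines G \<Longrightarrow> p \<in> L \<Longrightarrow> q \<in> L \<Longrightarrow> L \<subseteq> X"
  unfolding is_subspace_def by blast

lemma is_subspace_Inter:
  assumes "\<X> \<noteq> {}" "\<And>X. X \<in> \<X> \<Longrightarrow> is_subspace G X"
  shows "is_subspace G (\<Inter>\<X>)"
proof (rule is_subspaceI)
  show "\<Inter>\<X> \<subseteq> points G" using assms unfolding is_subspace_def by blast
next
  fix p q L r assume "p \<in> \<Inter>\<X>" "q \<in> \<Inter>\<X>" "p \<noteq> q" "L \<in> lines G" "p \<in> L" "q \<in> L" "r \<in> L"
  then show "r \<in> \<Inter>\<X>" using assms(2) by (meson InterE InterI is_subspaceD subsetD)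
qed

lemma is_subspace_Int: "is_subspace G X \<Longrightarrow> is_subspace G Y \<Longrightarrow> is_subspace G (X \<inter> Y)"
  using is_subspace_Inter[of "{X, Y}" G] by auto

lemma subset_spanned: "Z \<subseteq> spanned G Z"
  unfolding spanned_def by blast

lemma spanned_minimal: "is_subspace G X \<Longrightarrow> Z \<subseteq> X \<Longrightarrow> spanned G Z \<subseteq> X"
  unfolding spanned_def by blast

lemma spanned_mono: "Y \<subseteq> Z \<Longrightarrow> spanned G Y \<subseteq> spanned G Z"
  unfolding spanned_def by blast

lemma spanned_subspace: "is_subspace G X \<Longrightarrow> spanned G X = X"
  by (simp add: spanned_minimal subset_antisym subset_spanned)

text \<open>The ambient \<open>X\<close> keeps the intersected family nonempty; with no subspace
  around \<open>Z\<close> the span would be \<open>UNIV\<close>. Hence the ambient subspace in later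
  facts on spans.\<close>

lemma is_subspace_spanned:
  assumes "is_subspace G X" "Z \<subseteq> X"
  shows "is_subspace G (spanned G Z)"
  unfolding spanned_def by (rule is_subspace_Inter) (use assms in auto)

lemma spanned_eqI:
  assumes "is_subspace G X" "Y \<subseteq> X" "Z \<subseteq> spanned G Y" "Y \<subseteq> spanned G Z"
  shows "spanned G Y = spanned G Z"
proof
  have Y: "is_subspace G (spanned G Y)" using assms is_subspace_spanned by blast
  then have "is_subspace G (spanned G Z)" using assms(3) is_subspace_spanned by blast
  then show "spanned G Y \<subseteq> spanned G Z" using assms(4) spanned_minimal by blast
  show "spanned G Z \<subseteq> spanned G Y" using Y assms(3) spanned_minimal by blast
qed

lemma spanned_insert_spanned:
  assumes "is_subspace G X" "insert p Z \<subseteq> X"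
  shows "spanned G (insert p (spanned G Z)) = spanned G (insert p Z)"
proof (rule spanned_eqI)
  show "insert p (spanned G Z) \<subseteq> X" using assms spanned_minimal by blast
  show "insert p Z \<subseteq> spanned G (insert p (spanned G Z))"
    by (meson insert_mono order_trans subset_spanned)
  show "insert p (spanned G Z) \<subseteq> spanned G (insert p Z)"
    by (meson insertI1 insert_subset spanned_mono subset_insertI subset_spanned subsetD)
qed (fact assms)

text \<open>The pointwise form of independence, on which exchange operates; the definition compares
  spans of whole subsets.\<close>

lemma independent_set_notin_spanned:
  assumes "independent_set G Z" "is_subspace G X" "Z \<subseteq> X" "z \<in> Z"
  shows "z \<notin> spanned G (Z - {z})"
proof
  assume "z \<in> spanned G (Z - {z})"
  then have "Z \<subseteq> spanned G (Z - {z})" using subset_spanned[of "Z - {z}" G] by blast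
  then have "spanned G (Z - {z}) = spanned G Z"
    using assms spanned_eqI[of G X "Z - {z}" Z] subset_spanned[of Z G] by blast
  then show False using assms unfolding independent_set_def by blast
qed

lemma independent_setI:
  assumes "is_subspace G X" "Z \<subseteq> X" "\<And>z. z \<in> Z \<Longrightarrow> z \<notin> spanned G (Z - {z})"
  shows "independent_set G Z"
  unfolding independent_set_def
proof (intro conjI allI impI)
  show "Z \<subseteq> points G" using assms unfolding is_subspace_def by blast
  fix Y assume "Y \<subset> Z"
  then obtain z where z: "z \<in> Z" "Y \<subseteq> Z - {z}" by blast
  then show "spanned G Y \<noteq> spanned G Z"
    using assms(3)[OF z(1)] spanned_mono[OF z(2)] subset_spanned[of Z G] by blast
qed

lemma singular_subspace_subset:
  "singular_subspace G M \<Longrightarrow> is_subspace G X \<Longrightarrow> X \<subseteq> M \<Longrightarrow> singular_subspace G X"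
  unfolding singular_subspace_def by blast

lemma singular_subspaceD:
  "singular_subspace G M \<Longrightarrow> is_subspace G M"
  "singular_subspace G M \<Longrightarrow> p \<in> M \<Longrightarrow> q \<in> M \<Longrightarrow> collinear G p q"
  unfolding singular_subspace_def by auto

lemma singular_subspace_line:
  assumes "singular_subspace G M" "p \<in> M" "q \<in> M" "p \<noteq> q"
  obtains L where "L \<in> lines G" "p \<in> L" "q \<in> L" "L \<subseteq> M"
proof -
  obtain L where "L \<in> lines G" "p \<in> L" "q \<in> L"
    using assms unfolding singular_subspace_def collinear_def by blast
  then show ?thesis using that is_subspaceD[of G M p q L] assms singular_subspaceD(1)[of G M] by blast
qed

section \<open>Projective geometry inside singular subspaces\<close>

locale ranked_polar_space =
  fixes G :: "'p geometry" and n :: nat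
  assumes ranked: "polar_space_of_rank G n"
begin

lemma line_unique:
  assumes "L \<in> lines G" "M \<in> lines G" "p \<noteq> q" "p \<in> L" "q \<in> L" "p \<in> M" "q \<in> M"
  shows "L = M"
proof -
  have "\<forall>L\<in>lines G. \<forall>M\<in>lines G. \<forall>p q. p \<noteq> q \<and> {p, q} \<subseteq> L \<and> {p, q} \<subseteq> M \<longrightarrow> L = M"
    using ranked unfolding polar_space_of_rank_def polar_space_def partial_linear_space_def by simp
  from this[rule_format, OF assms(1,2), of p q] show ?thesis using assms by blast
qed

text \<open>Chains of singular subspaces are finite, so the union of a nonempty chain is one of its
  members and Zorn applies. This gives access to the projective axioms, which are stated for maximal
  singular subspaces only.\<close>

lemma singular_in_maximal:
  assumes "singular_subspace G S"
  obtains M where "maximal_singular_subspace G M" "S \<subseteq> M"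
proof -
  define \<A> where "\<A> = {X. singular_subspace G X \<and> S \<subseteq> X}"
  have "\<exists>M\<in>\<A>. \<forall>X\<in>\<A>. M \<subseteq> X \<longrightarrow> X = M"
  proof (rule subset_Zorn_nonempty)
    show "\<A> \<noteq> {}" using assms \<A>_def by blast
    fix \<C> assume ne: "\<C> \<noteq> {}" and ch: "subset.chain \<A> \<C>"
    have "subset.chain {X. singular_subspace G X} \<C>"
      using ch unfolding subset.chain_def \<A>_def by blast
    then have "finite \<C>" using ranked unfolding polar_space_of_rank_def polar_space_def by blast
    then have "\<Union>\<C> \<in> \<C>" using ne ch Union_in_chain by blast
    then show "\<Union>\<C> \<in> \<A>" using ch unfolding subset.chain_def by blast
  qed
  then show ?thesis using that unfolding maximal_singular_subspace_def \<A>_def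
    by (smt (verit) mem_Collect_eq order_trans)
qed

lemma veblen_young:
  assumes "singular_subspace G S"
    and "K \<in> lines G" "L \<in> lines G" "A \<in> lines G" "B \<in> lines G"
    and "K \<subseteq> S" "L \<subseteq> S" "A \<subseteq> S" "B \<subseteq> S"
    and "K \<noteq> L" "p \<in> K" "p \<in> L" "p \<notin> A" "p \<notin> B"
    and "a \<in> A" "a \<in> K" "a' \<in> A" "a' \<in> L" "b \<in> B" "b \<in> K" "b' \<in> B" "b' \<in> L"
  obtains c where "c \<in> A" "c \<in> B"
proof -
  obtain M where M: "maximal_singular_subspace G M" "S \<subseteq> M"
    using assms(1) singular_in_maximal by blast
  then have *: "projective_space (restriction G M)"
    using ranked unfolding polar_space_of_rank_def by blast
  have mem: "K \<in> lines (restriction G M)" "L \<in> lines (restriction G M)"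
    "A \<in> lines (restriction G M)" "B \<in> lines (restriction G M)"
    unfolding restriction_def using assms M by auto
  have "A \<inter> L \<noteq> {}" "A \<inter> K \<noteq> {}" "B \<inter> K \<noteq> {}" "B \<inter> L \<noteq> {}" using assms by auto
  then have "A \<inter> B \<noteq> {}"
    using *[unfolded projective_space_def, THEN conjunct2, THEN conjunct2, THEN conjunct2,
        rule_format, OF mem, of p] assms by blast
  then show ?thesis using that by blast
qed

text \<open>In a projective space, the span of a subspace \<open>S\<close> and a point
  \<open>p\<close> off it. Inserting \<open>p\<close> covers empty \<open>S\<close>. For
  \<open>p \<in> S\<close> the choice \<open>s = p\<close> would add every line through
  \<open>p\<close>, so \<open>p \<notin> S\<close> is required below.\<close>

definition join :: "'p set \<Rightarrow> 'p \<Rightarrow> 'p set" where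
  "join S p = insert p (S \<union> {x. \<exists>s\<in>S. \<exists>L\<in>lines G. p \<in> L \<and> s \<in> L \<and> x \<in> L})"

lemma joinI: "s \<in> S \<Longrightarrow> L \<in> lines G \<Longrightarrow> p \<in> L \<Longrightarrow> s \<in> L \<Longrightarrow> x \<in> L \<Longrightarrow> x \<in> join S p"
  unfolding join_def by blast

lemma join_subset:
  assumes "is_subspace G X" "S \<subseteq> X" "p \<in> X" "p \<notin> S"
  shows "join S p \<subseteq> X"
proof
  fix x assume "x \<in> join S p"
  then consider "x = p" | "x \<in> S" | s L where "s \<in> S" "L \<in> lines G" "p \<in> L" "s \<in> L" "x \<in> L"
    unfolding join_def by blast
  then show "x \<in> X"
  proof cases
    case (3 s L)
    then have "L \<subseteq> X" using is_subspaceD[of G X p s L] assms by blast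
    then show ?thesis using 3 by blast
  qed (use assms in auto)
qed

context
  fixes M S :: "'p set" and p :: 'p
  assumes M: "singular_subspace G M" and S: "is_subspace G S" "S \<subseteq> M" and p: "p \<in> M" "p \<notin> S"
begin

lemma join_subset_M: "join S p \<subseteq> M"
  using join_subset M S p singular_subspaceD(1) by blast

lemma join_line1:
  assumes a: "a \<in> S" and b: "b \<in> join S p" "b \<notin> S" and L: "L \<in> lines G" "a \<in> L" "b \<in> L"
  shows "L \<subseteq> join S p"
proof (cases "b = p")
  case True
  then show ?thesis using a L by (auto intro: joinI)
next
  case bp: False
  with b obtain s K where K: "s \<in> S" "K \<in> lines G" "p \<in> K" "s \<in> K" "b \<in> K"
    unfolding join_def by blast
  have KJ: "K \<subseteq> join S p" using K by (auto intro: joinI)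
  show ?thesis
  proof (cases "a \<in> K")
    case True
    then have "L = K" using line_unique[of L K a b] L K a b by blast
    then show ?thesis using KJ by simp
  next
    case aK: False
    have ab: "a \<noteq> b" using a b by blast
    have bM: "b \<in> M" using b join_subset_M by blast
    have subM: "Q \<subseteq> M" if "Q \<in> lines G" "x \<in> Q" "y \<in> Q" "x \<in> M" "y \<in> M" "x \<noteq> y" for Q x y
      using that M is_subspaceD singular_subspaceD(1) by metis
    have LM: "L \<subseteq> M" using subM L ab bM a S by blast
    have KM: "K \<subseteq> M" using KJ join_subset_M by blast
    show ?thesis
    proof
      fix c assume c: "c \<in> L"
      show "c \<in> join S p"
      proof (cases "c = a \<or> c \<in> K")
        case True
        then show ?thesis using a KJ unfolding join_def by blast
      next
        case False
        have cM: "c \<in> M" using c LM by blast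
        \<comment> \<open>The lines \<open>A\<close> through \<open>a\<close>, \<open>s\<close> and
          \<open>B\<close> through \<open>p\<close>, \<open>c\<close> both meet the sides
          \<open>L\<close> and \<open>K\<close> of the triangle with vertex \<open>b\<close>. So
          they share a point \<open>d\<close>, which lies in \<open>S\<close>, and \<open>c\<close>
          is on the line from \<open>p\<close> to \<open>d\<close>.\<close>
        have "a \<noteq> s" using aK K by blast
        then obtain A where A: "A \<in> lines G" "a \<in> A" "s \<in> A"
          using singular_subspace_line[OF M] a K S by (metis subsetD)
        then have AS: "A \<subseteq> S" using is_subspaceD[OF S(1)] a K \<open>a \<noteq> s\<close> by metis
        have "c \<noteq> p" using False K by blast
        then obtain B where B: "B \<in> lines G" "p \<in> B" "c \<in> B" "B \<subseteq> M"
          using singular_subspace_line[OF M p(1) cM] by metis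
        have "b \<notin> B" using line_unique[of B K b p] B K bp False by blast
        moreover have "b \<notin> A" using AS b by blast
        moreover have "L \<noteq> K" using aK L by blast
        ultimately obtain d where "d \<in> A" "d \<in> B"
          using veblen_young[OF M L(1) K(2) A(1) B(1) LM KM _ B(4), of b a s c p]
            AS S L K A B c by blast
        then show ?thesis using AS B by (auto intro: joinI)
      qed
    qed
  qed
qed

lemma is_subspace_join: "is_subspace G (join S p)"
proof (rule is_subspaceI)
  show "join S p \<subseteq> points G"
    using join_subset_M M unfolding singular_subspace_def is_subspace_def by blast
next
  fix a b L r
  assume a: "a \<in> join S p" and b: "b \<in> join S p" and ab: "a \<noteq> b"
    and L: "L \<in> lines G" "a \<in> L" "b \<in> L" and r: "r \<in> L"
  have "L \<subseteq> join S p"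
  proof (cases "a \<in> S \<or> b \<in> S")
    case True
    moreover have "L \<subseteq> S" if "a \<in> S" "b \<in> S"
      using is_subspaceD[OF S(1) that ab L] .
    moreover have "S \<subseteq> join S p" unfolding join_def by blast
    ultimately show ?thesis
      using join_line1[of a b L] join_line1[of b a L] a b L by auto
  next
    case nS: False
    show ?thesis
    proof (cases "a = p \<or> b = p")
      case True
      then obtain c where c: "c \<in> join S p" "c \<noteq> p" "c \<in> L" "c \<notin> S" "p \<in> L"
        using a b ab L nS by metis
      then obtain s K where K: "s \<in> S" "K \<in> lines G" "p \<in> K" "s \<in> K" "c \<in> K"
        unfolding join_def by blast
      then have "L = K" using line_unique[of L K c p] L c by blast
      then show ?thesis using K by (auto intro: joinI)
    next
      case np: False
      then obtain s K where K: "s \<in> S" "K \<in> lines G" "p \<in> K" "s \<in> K" "a \<in> K"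
        using a nS unfolding join_def by blast
      obtain t J where J: "t \<in> S" "J \<in> lines G" "p \<in> J" "t \<in> J" "b \<in> J"
        using b nS np unfolding join_def by blast
      have KM: "K \<subseteq> M" "J \<subseteq> M"
        using joinI[OF K(1-4)] joinI[OF J(1-4)] join_subset_M by auto
      show ?thesis
      proof (cases "K = J")
        case True
        then have "L = K" using line_unique[of L K a b] L K J ab by blast
        then show ?thesis using K by (auto intro: joinI)
      next
        case KJ: False
        \<comment> \<open>Veblen-Young at the vertex \<open>p\<close>: \<open>L\<close> and the line
          \<open>T\<close> through \<open>s\<close>, \<open>t\<close> both meet \<open>K\<close> and
          \<open>J\<close>, so \<open>L\<close> has a point in \<open>S\<close> and the case of
          \<open>join_line1\<close> is reached.\<close>
        have st: "s \<noteq> t" using line_unique[of K J p s] K J KJ p by blast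
        then obtain T where T: "T \<in> lines G" "s \<in> T" "t \<in> T"
          using singular_subspace_line[OF M] K J S by (metis subsetD)
        then have TS: "T \<subseteq> S" using is_subspaceD[OF S(1)] K J st by metis
        have LM: "L \<subseteq> M" using is_subspaceD[OF singular_subspaceD(1)[OF M] _ _ ab L]
          using KM K J by blast
        have "p \<notin> L" using line_unique[of L K a p] line_unique[of L J b p] L K J KJ np by blast
        then obtain c where c: "c \<in> L" "c \<in> T"
          using veblen_young[OF M K(2) J(2) L(1) T(1) KM LM _ KJ K(3) J(3) _ _
              L(2) K(5) L(3) J(5) T(2) K(4) T(3) J(4)] TS S p by blast
        then show ?thesis using join_line1[of c a L] TS a nS L by auto
      qed
    qed
  qed
  then show "r \<in> join S p" using r by blast
qed

lemma spanned_insert_eq_join: "spanned G (insert p S) = join S p"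
proof
  show "spanned G (insert p S) \<subseteq> join S p"
    by (rule spanned_minimal[OF is_subspace_join]) (auto simp: join_def)
  have "insert p S \<subseteq> M" using S p by blast
  then show "join S p \<subseteq> spanned G (insert p S)"
    by (meson M p(2) insert_subset is_subspace_spanned join_subset singular_subspaceD(1) subset_spanned)
qed

end

section \<open>Exchange, bases and dimension\<close>

lemma spanned_exchange:
  assumes M: "singular_subspace G M" and X: "X \<subseteq> M" "p \<in> M"
    and q: "q \<in> spanned G (insert p X)" "q \<notin> spanned G X"
  shows "p \<in> spanned G (insert q X)"
proof (cases "p \<in> spanned G X")
  case True
  then show ?thesis using spanned_mono[of X "insert q X"] by blast
next
  case False
  let ?S = "spanned G X"
  have subM: "is_subspace G M" by (rule singular_subspaceD(1)[OF M])
  have S: "is_subspace G ?S" "?S \<subseteq> M"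
    using is_subspace_spanned[OF subM X(1)] spanned_minimal[OF subM X(1)] by auto
  have eq: "spanned G (insert p X) = join ?S p"
    using spanned_insert_spanned[of G M p X] subM X spanned_insert_eq_join[OF M S X(2) False] by auto
  show ?thesis
  proof (cases "q = p")
    case True
    then show ?thesis using subset_spanned[of "insert q X"] by blast
  next
    case qp: False
    \<comment> \<open>Since \<open>q\<close> is off the span of \<open>X\<close>, it differs from
      \<open>s\<close>; the line that leads from \<open>p\<close> and \<open>s\<close> to
      \<open>q\<close> therefore also leads from \<open>s\<close> and \<open>q\<close> back to
      \<open>p\<close>.\<close>
    then obtain s L where L: "s \<in> ?S" "L \<in> lines G" "p \<in> L" "s \<in> L" "q \<in> L"
      using q eq unfolding join_def by blast
    have "spanned G (insert p X) \<subseteq> M" by (rule spanned_minimal[OF subM]) (use X in auto)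
    then have "q \<in> M" using q by blast
    then have "is_subspace G (spanned G (insert q X))" using is_subspace_spanned[OF subM] X by blast
    moreover have "s \<in> spanned G (insert q X)" "q \<in> spanned G (insert q X)"
      using L spanned_mono[OF subset_insertI, of G X q] subset_spanned[of "insert q X" G] by auto
    moreover have "s \<noteq> q" using L q by blast
    ultimately show ?thesis using is_subspaceD[of G _ s q L] L by blast
  qed
qed

lemma independent_insert:
  assumes M: "singular_subspace G M" and I: "independent_set G I" "I \<subseteq> M"
    and g: "g \<in> M" "g \<notin> spanned G I"
  shows "independent_set G (insert g I)"
proof (rule independent_setI)
  show subM: "is_subspace G M" by (rule singular_subspaceD(1)[OF M])
  show "insert g I \<subseteq> M" using I g by blast
  fix z assume z: "z \<in> insert g I"
  have gI: "g \<notin> I" using g subset_spanned[of I G] by blast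
  show "z \<notin> spanned G (insert g I - {z})"
  proof (cases "z = g")
    case True
    then show ?thesis using g gI by simp
  next
    case False
    then have zI: "z \<in> I" using z by blast
    have "z \<notin> spanned G (I - {z})" using independent_set_notin_spanned[OF I(1) subM I(2) zI] .
    moreover have eqs: "insert z (I - {z}) = I" "insert g I - {z} = insert g (I - {z})"
      using zI False by auto
    moreover have "I - {z} \<subseteq> M" using I by blast
    ultimately show ?thesis
      using spanned_exchange[OF M _ g(1), of "I - {z}" z] g(2) by metis
  qed
qed

lemma independent_subset:
  assumes M: "is_subspace G M" and I: "independent_set G I" "I \<subseteq> M" and J: "J \<subseteq> I"
  shows "independent_set G J"
proof (rule independent_setI[OF M])
  show "J \<subseteq> M" using I J by blast
  fix z assume z: "z \<in> J"
  then have "z \<notin> spanned G (I - {z})"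
    using independent_set_notin_spanned[OF I(1) M I(2)] J by auto
  moreover have "J - {z} \<subseteq> I - {z}" using J by blast
  ultimately show "z \<notin> spanned G (J - {z})"
    using spanned_mono[of "J - {z}" "I - {z}" G] by auto
qed

text \<open>Steinitz replacement: an element \<open>b\<close> of \<open>I\<close> outside
  \<open>H\<close> is traded for some \<open>g\<close> in \<open>H\<close> outside the span of
  \<open>I - {b}\<close>. Such a \<open>g\<close> exists, as otherwise that span would contain the
  span of \<open>H\<close>, and so \<open>b\<close>. The size is kept while \<open>I - H\<close>
  shrinks.\<close>

lemma independent_card_le:
  assumes M: "singular_subspace G M" and H: "finite H" "H \<subseteq> M"
    and "finite I" "independent_set G I" "I \<subseteq> spanned G H"
  shows "card I \<le> card H"
  using assms(4-)
proof (induction "card (I - H)" arbitrary: I rule: less_induct)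
  case (less I)
  have subM: "is_subspace G M" by (rule singular_subspaceD(1)[OF M])
  have HM: "spanned G H \<subseteq> M" using spanned_minimal[OF subM H(2)] .
  then have IM: "I \<subseteq> M" using less by blast
  show ?case
  proof (cases "I \<subseteq> H")
    case True
    then show ?thesis using H card_mono by blast
  next
    case False
    then obtain b where b: "b \<in> I" "b \<notin> H" by blast
    let ?I = "I - {b}"
    have sub: "is_subspace G (spanned G ?I)" by (rule is_subspace_spanned[OF subM]) (use IM in auto)
    have "b \<notin> spanned G ?I" using independent_set_notin_spanned[OF less(3) subM IM b(1)] .
    then have "\<not> H \<subseteq> spanned G ?I" using spanned_minimal[OF sub] less(4) b by blast
    then obtain g where g: "g \<in> H" "g \<notin> spanned G ?I" by blast
    have gI: "g \<notin> ?I" using g subset_spanned[of ?I G] by blast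
    have "independent_set G (insert g ?I)"
      by (rule independent_insert[OF M independent_subset[OF subM less(3) IM]]) (use IM g H in auto)
    moreover have "insert g ?I \<subseteq> spanned G H" using less(4) g subset_spanned[of H G] by blast
    moreover have "card (insert g ?I - H) < card (I - H)"
      by (rule psubset_card_mono) (use less(2) b g in auto)
    ultimately have "card (insert g ?I) \<le> card H" using less(1)[of "insert g ?I"] less(2) by blast
    moreover have "card (insert g ?I) = card I"
      using less(2) b gI by (metis card_Suc_Diff1 card_insert_disjoint finite_Diff)
    ultimately show ?thesis by simp
  qed
qed

lemma has_dim_unique:
  assumes "singular_subspace G X" "has_dim G X d" "has_dim G X e"
  shows "d = e"
proof -
  obtain B where B: "finite B" "independent_set G B" "spanned G B = X" "int (card B) = d + 1"
    using assms unfolding has_dim_def by blast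
  obtain C where C: "finite C" "independent_set G C" "spanned G C = X" "int (card C) = e + 1"
    using assms unfolding has_dim_def by blast
  have "B \<subseteq> X" "C \<subseteq> X" using B(3) C(3) subset_spanned[of B G] subset_spanned[of C G] by auto
  then have "card B \<le> card C" "card C \<le> card B"
    using independent_card_le[OF assms(1)] B C by auto
  then show ?thesis using B C by simp
qed

lemma has_dim_insert:
  assumes M: "singular_subspace G M" and S: "has_dim G S d" "S \<subseteq> M" and p: "p \<in> M" "p \<notin> S"
  shows "has_dim G (spanned G (insert p S)) (d + 1)"
proof -
  obtain B where B: "finite B" "independent_set G B" "spanned G B = S" "int (card B) = d + 1"
    using S unfolding has_dim_def by blast
  have BS: "B \<subseteq> S" using B(3) subset_spanned[of B G] by simp
  have "independent_set G (insert p B)"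
    using independent_insert[OF M B(2)] B S p BS by blast
  moreover have "spanned G (insert p B) = spanned G (insert p S)"
    using spanned_insert_spanned[of G M p B] singular_subspaceD(1)[OF M] BS B S p by auto
  moreover have "card (insert p B) = Suc (card B)" using BS B p by (meson card_insert_disjoint subsetD)
  ultimately show ?thesis unfolding has_dim_def
    using B by (intro exI[of _ "insert p B"]) auto
qed

text \<open>A largest independent subset of \<open>S\<close> is a base of \<open>S\<close>; its size
  is bounded by a base of \<open>M\<close>. If \<open>S\<close> is proper, a point of
  \<open>M\<close> off \<open>S\<close> still extends it, which makes the inequality strict.\<close>

lemma has_dim_subspace:
  assumes M: "singular_subspace G M" and e: "has_dim G M e" and S: "is_subspace G S" "S \<subseteq> M"
  obtains d where "has_dim G S d" "d \<le> e" "S \<noteq> M \<Longrightarrow> d < e"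
proof -
  obtain C where C: "finite C" "spanned G C = M" "int (card C) = e + 1"
    using e unfolding has_dim_def by blast
  have CM: "C \<subseteq> M" using C(2) subset_spanned[of C G] by simp
  define P where "P = (\<lambda>c. \<exists>B. finite B \<and> independent_set G B \<and> B \<subseteq> S \<and> card B = c)"
  have bound: "c \<le> card C" if "P c" for c
    using that independent_card_le[OF M C(1) CM] S C unfolding P_def by blast
  have "independent_set G {}" unfolding independent_set_def by blast
  then have "P 0" unfolding P_def by (intro exI[of _ "{}"]) auto
  then have PG: "P (Greatest P)" using GreatestI_nat bound by metis
  then obtain B where B: "finite B" "independent_set G B" "B \<subseteq> S" "card B = Greatest P"
    unfolding P_def by blast
  have BM: "B \<subseteq> M" using B S by blast
  have "spanned G B = S"
  proof (rule ccontr)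
    assume "spanned G B \<noteq> S"
    then obtain p where p: "p \<in> S" "p \<notin> spanned G B" using spanned_minimal[OF S(1) B(3)] by blast
    then have "independent_set G (insert p B)" using independent_insert[OF M B(2) BM] S by blast
    moreover have "card (insert p B) = Suc (card B)"
      using p B subset_spanned by (metis card_insert_disjoint subsetD)
    ultimately have "P (Suc (card B))" using B p unfolding P_def by (metis finite_insert insert_subset)
    then show False using B Greatest_le_nat[of P "Suc (card B)" "card C"] bound by simp
  qed
  then have d: "has_dim G S (int (card B) - 1)" unfolding has_dim_def
    using B by (intro exI[of _ B]) auto
  have le: "int (card B) - 1 \<le> e" using bound[OF PG] B C by simp
  have "int (card B) - 1 < e" if ne: "S \<noteq> M"
  proof -
    obtain p where p: "p \<in> M" "p \<notin> spanned G B" using ne S \<open>spanned G B = S\<close> by blast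
    then have "independent_set G (insert p B)" using independent_insert[OF M B(2) BM] by blast
    then have "card (insert p B) \<le> card C"
      using independent_card_le[OF M C(1) CM] B BM p C by simp
    moreover have "card (insert p B) = Suc (card B)"
      using p B subset_spanned by (metis card_insert_disjoint subsetD)
    ultimately show ?thesis using C by simp
  qed
  then show ?thesis using that d le by blast
qed

lemma has_dim_eq:
  assumes M: "singular_subspace G M" "has_dim G M d" and S: "has_dim G S d" "is_subspace G S" "S \<subseteq> M"
  shows "S = M"
  using has_dim_subspace[OF M S(2,3)] has_dim_unique[OF singular_subspace_subset[OF M(1) S(2,3)] S(1)]
  by (metis less_irrefl)

section \<open>Hyperplanes of a singular subspace\<close>

lemma hyperplane_join:
  assumes M: "singular_subspace G M" "has_dim G M (d + 1)"
    and S: "has_dim G S d" "is_subspace G S" "S \<subseteq> M" and p: "p \<in> M" "p \<notin> S"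
  shows "spanned G (insert p S) = M"
proof (rule has_dim_eq[OF M])
  show "has_dim G (spanned G (insert p S)) (d + 1)"
    using has_dim_insert M S p by blast
  show "is_subspace G (spanned G (insert p S))"
    by (rule is_subspace_spanned[OF singular_subspaceD(1)[OF M(1)]]) (use S p in auto)
  show "spanned G (insert p S) \<subseteq> M"
    by (rule spanned_minimal[OF singular_subspaceD(1)[OF M(1)]]) (use S p in auto)
qed

text \<open>The modular law for a hyperplane: a point \<open>x\<close> of \<open>S\<close> other
  than \<open>p\<close> and off \<open>H\<close> is on a line from \<open>p\<close> to some
  \<open>s\<close> in \<open>H\<close>; as \<open>p\<close> and \<open>x\<close> are in
  \<open>S\<close>, so is \<open>s\<close>.\<close>

lemma hyperplane_Int_join:
  assumes M: "singular_subspace G M" "has_dim G M (d + 1)"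
    and H: "has_dim G H d" "is_subspace G H" "H \<subseteq> M"
    and S: "is_subspace G S" "S \<subseteq> M" and p: "p \<in> S" "p \<notin> H"
  shows "spanned G (insert p (S \<inter> H)) = S"
proof -
  have sS: "singular_subspace G S" using singular_subspace_subset M S by blast
  have sI: "is_subspace G (S \<inter> H)" using is_subspace_Int S H by blast
  have "S \<subseteq> join (S \<inter> H) p"
  proof
    fix x assume x: "x \<in> S"
    have "M = join H p"
      using hyperplane_join[OF M H] spanned_insert_eq_join[OF M(1) H(2,3)] S p by blast
    then have "x \<in> join H p" using x S by blast
    then consider "x = p" | "x \<in> H" | s L where "x \<noteq> p" "s \<in> H" "L \<in> lines G" "p \<in> L" "s \<in> L" "x \<in> L"
      unfolding join_def by blast
    then show "x \<in> join (S \<inter> H) p"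
    proof cases
      case 3
      then have "L \<subseteq> S" using is_subspaceD[OF S(1) p(1) x] by blast
      then have "s \<in> S" using 3 by blast
      then show ?thesis using 3 by (auto intro: joinI)
    qed (use x in \<open>auto simp: join_def\<close>)
  qed
  then show ?thesis
    using join_subset[of S "S \<inter> H" p] S p spanned_insert_eq_join[OF sS sI _ p(1)] by auto
qed

text \<open>One point off \<open>H\<close> restores \<open>S\<close> from
  \<open>S \<inter> H\<close>, so exactly one dimension is lost.\<close>

lemma hyperplane_Int:
  assumes M: "singular_subspace G M" "has_dim G M (d + 1)"
    and H: "has_dim G H d" "is_subspace G H" "H \<subseteq> M"
    and S: "has_dim G S e" "is_subspace G S" "S \<subseteq> M" "\<not> S \<subseteq> H"
  shows "has_dim G (S \<inter> H) (e - 1)"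
proof -
  obtain p where p: "p \<in> S" "p \<notin> H" using S by blast
  have sS: "singular_subspace G S" using singular_subspace_subset M S by blast
  have sI: "is_subspace G (S \<inter> H)" using is_subspace_Int S H by blast
  obtain d' where d': "has_dim G (S \<inter> H) d'"
    using has_dim_subspace[OF sS S(1) sI] by blast
  then have "has_dim G S (d' + 1)"
    using has_dim_insert[OF sS d' _ p(1)] hyperplane_Int_join[OF M H S(2,3) p] p by auto
  then have "d' = e - 1" using has_dim_unique[OF sS S(1)] by fastforce
  then show ?thesis using d' by simp
qed

text \<open>The one-or-all axiom: two points of a line collinear with \<open>p\<close> exclude the
  alternative of exactly one.\<close>

lemma is_subspace_perp:
  assumes "p \<in> points G"
  shows "is_subspace G {q \<in> points G. collinear G p q}"
proof (rule is_subspaceI)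
  fix a b L r
  assume a: "a \<in> {q \<in> points G. collinear G p q}" and b: "b \<in> {q \<in> points G. collinear G p q}"
    and ab: "a \<noteq> b" and L: "L \<in> lines G" "a \<in> L" "b \<in> L" "r \<in> L"
  have "\<forall>p\<in>points G. \<forall>L\<in>lines G.
    (\<exists>!q. q \<in> L \<and> collinear G p q) \<or> (\<forall>q\<in>L. collinear G p q)"
    using ranked unfolding polar_space_of_rank_def polar_space_def by simp
  from this[rule_format, OF assms L(1)] have "collinear G p r" using a b ab L by blast
  moreover have "\<forall>L\<in>lines G. L \<subseteq> points G"
    using ranked unfolding polar_space_of_rank_def polar_space_def partial_linear_space_def by simp
  then have "r \<in> points G" using L by blast
  ultimately show "r \<in> {q \<in> points G. collinear G p q}" by simp
qed simp

end

section \<open>Hyperplanes as points of the Grassmann space\<close>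

lemma grassmannianD:
  assumes "X \<in> grassmannian G d"
  shows "singular_subspace G X" "has_dim G X d" "is_subspace G X"
  using assms unfolding grassmannian_def singular_subspace_def by auto

lemma grassmannianI: "singular_subspace G X \<Longrightarrow> has_dim G X d \<Longrightarrow> X \<in> grassmannian G d"
  unfolding grassmannian_def by simp

context ranked_polar_space
begin

lemma grassmannian_subspace:
  assumes "U \<in> grassmannian G e" "is_subspace G X" "X \<subseteq> U" "has_dim G X d"
  shows "X \<in> grassmannian G d"
  using assms singular_subspace_subset[of G U X] grassmannianD(1)[of U G e] grassmannianI[of G X d] by simp

lemma grassmannian_subset_eq:
  assumes "X \<in> grassmannian G d" "Y \<in> grassmannian G d" "X \<subseteq> Y"
  shows "X = Y"
  using has_dim_eq[of Y d X] grassmannianD[OF assms(1)] grassmannianD[OF assms(2)] assms(3) by simp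

text \<open>Duality: inside a top, the lines of the Grassmann space are those of the dual projective space.\<close>

lemma hyperplane_in_spanned:
  assumes U: "U \<in> grassmannian G (d + 1)"
    and \<H>: "finite \<H>" "\<H> \<noteq> {}" "\<H> \<subseteq> subspaces_below G d U"
    and H: "H \<in> subspaces_below G d U" "\<Inter>\<H> \<subseteq> H"
  shows "H \<in> spanned (grassmann_space G d) \<H>"
  unfolding spanned_def
proof (rule InterI)
  fix \<X> assume "\<X> \<in> {X. is_subspace (grassmann_space G d) X \<and> \<H> \<subseteq> X}"
  then have \<X>: "is_subspace (grassmann_space G d) \<X>" "\<H> \<subseteq> \<X>" by auto
  note dU = grassmannianD[OF U]
  from \<H> \<X>(2) H show "H \<in> \<X>"
  proof (induction \<H> arbitrary: H rule: finite_ne_induct)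
    case (singleton K)
    then have "K = H" using grassmannian_subset_eq[of K d H] unfolding subspaces_below_def by simp
    then show ?case using singleton by simp
  next
    case (insert K F)
    let ?D = "\<Inter>F"
    have KU: "K \<in> grassmannian G d" "K \<subseteq> U" and HU: "H \<in> grassmannian G d" "H \<subseteq> U"
      using insert.prems unfolding subspaces_below_def by auto
    note dK = grassmannianD[OF KU(1)] and dH = grassmannianD[OF HU(1)]
    have FU: "F \<subseteq> subspaces_below G d U" and FX: "F \<subseteq> \<X>" and KX: "K \<in> \<X>"
      using insert.prems by auto
    have IH: "H' \<in> \<X>" if "H' \<in> subspaces_below G d U" "?D \<subseteq> H'" for H'
      using insert.IH[OF FU FX that] .
    have subD: "is_subspace G ?D"
      by (rule is_subspace_Inter[OF insert.hyps(2)]) (use FU in \<open>auto simp: subspaces_below_def dest: grassmannianD(3)\<close>)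
    have DU: "?D \<subseteq> U" using FU insert.hyps(2) unfolding subspaces_below_def by auto
    show ?case
    proof (cases "?D \<subseteq> H \<or> H = K")
      case True
      then show ?thesis using IH insert.prems KX by auto
    next
      case False
      then have "\<not> H \<subseteq> K" using grassmannian_subset_eq[OF HU(1) KU(1)] by blast
      then have E: "has_dim G (H \<inter> K) (d - 1)"
        using hyperplane_Int[OF dU(1,2) dK(2,3) KU(2) dH(2,3) HU(2)] by blast
      have subE: "is_subspace G (H \<inter> K)" using is_subspace_Int dH(3) dK(3) .
      have EU: "H \<inter> K \<subseteq> U" using HU by blast
      have DK: "?D \<inter> K \<subseteq> H" using insert.prems by auto
      then obtain p where p: "p \<in> ?D" "p \<notin> K" using False by blast
      have pU: "p \<in> U" using p DU by blast
      \<comment> \<open>\<open>?K'\<close> is the hyperplane through \<open>H \<inter> K\<close> and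
        \<open>p\<close>. By the modular law \<open>?D\<close> is spanned by \<open>p\<close> and
        \<open>?D \<inter> K\<close>, so it lies in \<open>?K'\<close> and the induction hypothesis
        applies to \<open>?K'\<close>. Then \<open>H\<close> is on the Grassmann line joining
        \<open>K\<close> and \<open>?K'\<close>.\<close>
      let ?K' = "spanned G (insert p (H \<inter> K))"
      have "has_dim G ?K' (d - 1 + 1)"
        by (rule has_dim_insert[OF dU(1) E EU pU]) (use p in auto)
      then have dK': "has_dim G ?K' d" by simp
      have K'U: "?K' \<subseteq> U" by (rule spanned_minimal[OF dU(3)]) (use pU EU in auto)
      have "is_subspace G ?K'" by (rule is_subspace_spanned[OF dU(3)]) (use pU EU in auto)
      then have K'gr: "?K' \<in> grassmannian G d" using grassmannian_subspace[OF U _ K'U dK'] by blast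
      have "?D = spanned G (insert p (?D \<inter> K))"
        using hyperplane_Int_join[OF dU(1,2) dK(2,3) KU(2) subD DU p] by simp
      also have "\<dots> \<subseteq> ?K'" by (rule spanned_mono) (use DK in auto)
      finally have K'X: "?K' \<in> \<X>" using IH[of ?K'] K'gr K'U unfolding subspaces_below_def by simp
      have pK': "insert p (H \<inter> K) \<subseteq> ?K'" by (rule subset_spanned)
      let ?L = "subspaces_between G d (H \<inter> K) U"
      have "H \<inter> K \<in> grassmannian G (d - 1)" using grassmannian_subspace[OF U subE EU E] .
      then have "?L \<in> lines (grassmann_space G d)" unfolding grassmann_space_def using U EU by auto
      moreover have "?K' \<in> ?L" "K \<in> ?L" "H \<in> ?L"
        unfolding subspaces_between_def using K'gr KU HU K'U pK' by auto
      moreover have "?K' \<noteq> K" using p pK' by auto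
      ultimately show ?thesis using is_subspaceD[OF \<X>(1) K'X KX] by blast
    qed
  qed
qed

lemma is_subspace_grassmannian: "is_subspace (grassmann_space G d) (grassmannian G d)"
  by (rule is_subspaceI) (auto simp: grassmann_space_def subspaces_between_def)

context
  fixes U :: "'p set" and d :: int and Z :: "'p set set"
  assumes U: "U \<in> grassmannian G (d + 1)" and Z: "Z \<subseteq> subspaces_below G d U"
    and ind: "independent_set (grassmann_space G d) Z"
begin

lemma independent_Inter_not_subset:
  assumes "finite \<H>" "\<H> \<noteq> {}" "\<H> \<subseteq> Z" "H \<in> Z" "H \<notin> \<H>"
  shows "\<not> \<Inter>\<H> \<subseteq> H"
proof
  assume *: "\<Inter>\<H> \<subseteq> H"
  have "H \<in> spanned (grassmann_space G d) \<H>"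
    by (rule hyperplane_in_spanned[OF U]) (use assms * Z in auto)
  moreover have "\<H> \<subseteq> Z - {H}" using assms by blast
  ultimately have "H \<in> spanned (grassmann_space G d) (Z - {H})"
    using spanned_mono[of \<H> "Z - {H}" "grassmann_space G d"] by blast
  moreover have "Z \<subseteq> grassmannian G d" using Z unfolding subspaces_below_def by blast
  ultimately show False
    using independent_set_notin_spanned[OF ind is_subspace_grassmannian _ assms(4)] by blast
qed

text \<open>By independence each further hyperplane cuts the intersection so far properly, hence by
  exactly one dimension, starting from \<open>d\<close> for a single one.\<close>

lemma independent_Inter_dim:
  assumes "finite \<H>" "\<H> \<noteq> {}" "\<H> \<subseteq> Z"
  shows "\<Inter>\<H> \<in> grassmannian G (d + 1 - int (card \<H>))"
  using assms
proof (induction \<H> rule: finite_ne_induct)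
  case (singleton H)
  then show ?case using Z unfolding subspaces_below_def by auto
next
  case (insert H F)
  note dU = grassmannianD[OF U]
  have H: "H \<in> grassmannian G d" "H \<subseteq> U" using insert.prems Z unfolding subspaces_below_def by auto
  note dH = grassmannianD[OF H(1)]
  have FZ: "F \<subseteq> Z" using insert.prems by blast
  note dF = grassmannianD[OF insert.IH[OF FZ]]
  have FU: "\<Inter>F \<subseteq> U" using FZ Z insert.hyps(2) unfolding subspaces_below_def by auto
  have "\<not> \<Inter>F \<subseteq> H" using independent_Inter_not_subset[of F H] insert FZ by blast
  then have *: "has_dim G (\<Inter>F \<inter> H) (d + 1 - int (card F) - 1)"
    using hyperplane_Int[OF dU(1,2) dH(2,3) H(2) dF(2,3) FU] by blast
  have "\<Inter>(insert H F) = \<Inter>F \<inter> H" by auto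
  moreover have "is_subspace G (\<Inter>F \<inter> H)" using is_subspace_Int dF(3) dH(3) .
  moreover have "d + 1 - int (card (insert H F)) = d + 1 - int (card F) - 1"
    using insert.hyps by simp
  moreover have "\<Inter>F \<inter> H \<subseteq> U" using H(2) by blast
  ultimately show ?case using grassmannian_subspace[OF U _ _ *] by metis
qed

end

end

section \<open>Singular subsets of signed indices\<close>

lemma finite_signed_indices: "finite (signed_indices l)"
proof (rule finite_subset)
  show "signed_indices l \<subseteq> {- int l..int l}" unfolding signed_indices_def by auto
qed simp

lemma card_signed_indices: "card (signed_indices l) = 2 * l"
proof -
  have "signed_indices l = {- int l..int l} - {0}" unfolding signed_indices_def by auto
  then show ?thesis by simp
qed

lemma finite_singular_subset: "singular_subset l X \<Longrightarrow> finite X"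
  unfolding singular_subset_def using finite_signed_indices finite_subset by blast

lemma singular_subset_mono: "singular_subset l Y \<Longrightarrow> X \<subseteq> Y \<Longrightarrow> singular_subset l X"
  unfolding singular_subset_def by blast

lemma singular_subset_insert:
  assumes "singular_subset l X" "t \<in> signed_indices l" "- t \<notin> X"
  shows "singular_subset l (insert t X)"
proof -
  have "t \<noteq> 0" using assms(2) unfolding signed_indices_def by simp
  moreover have "j \<noteq> t" if "- j = t" "j = t" for j using that \<open>t \<noteq> 0\<close> by auto
  ultimately show ?thesis using assms unfolding singular_subset_def by auto
qed

text \<open>\<open>Y\<close> uses up at most \<open>card Y\<close> of the \<open>l\<close> absolute
  values.\<close>

lemma singular_subset_fresh:
  assumes "singular_subset l Y" "card Y < l"
  obtains t where "t \<in> signed_indices l" "t \<notin> Y" "- t \<notin> Y"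
proof -
  have fin: "finite Y" using assms finite_singular_subset by blast
  have "card (abs ` Y) < card {1..int l}" using card_image_le[OF fin, of abs] assms(2) by simp
  then have "\<not> {1..int l} \<subseteq> abs ` Y" using card_mono[OF finite_imageI[OF fin]] by (meson not_less)
  then obtain t where t: "t \<in> {1..int l}" "t \<notin> abs ` Y" by blast
  have "t \<notin> Y" "- t \<notin> Y" using t by force+
  moreover have "t \<in> signed_indices l" using t unfolding signed_indices_def by auto
  ultimately show ?thesis using that by blast
qed

lemma singular_subset_extend:
  assumes "singular_subset l A" "card A \<le> c" "c \<le> l"
  obtains Y where "singular_subset l Y" "A \<subseteq> Y" "card Y = c"
  using assms
proof (induction "c - card A" arbitrary: A thesis)
  case 0
  then show ?case by simp
next
  case (Suc d)
  have "card A < l" using Suc by simp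
  then obtain t where t: "t \<in> signed_indices l" "t \<notin> A" "- t \<notin> A"
    using singular_subset_fresh[OF Suc.prems(2)] by blast
  have "card (insert t A) = Suc (card A)" using t finite_singular_subset[OF Suc.prems(2)] by simp
  then have d: "d = c - card (insert t A)" "card (insert t A) \<le> c" using Suc by auto
  obtain Y where "singular_subset l Y" "insert t A \<subseteq> Y" "card Y = c"
    using Suc.hyps(1)[OF d(1) _ singular_subset_insert[OF Suc.prems(2) t(1,3)] d(2) Suc.prems(4)]
    by blast
  then show ?case using Suc.prems(1)[of Y] by blast
qed

text \<open>Connectedness as an induction principle on \<open>card (Y' - Y)\<close>. The step
  demands that \<open>insert t Y\<close>, not just the exchanged set, be singular, because the
  triangle argument needs the old and the new index in one singular set.\<close>

lemma singular_subset_connected: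
  assumes step: "\<And>Y y t. P Y \<Longrightarrow> singular_subset l Y \<Longrightarrow> card Y = c \<Longrightarrow> A \<subseteq> Y \<Longrightarrow> y \<in> Y \<Longrightarrow> y \<notin> A
      \<Longrightarrow> t \<notin> Y \<Longrightarrow> singular_subset l (insert t Y) \<Longrightarrow> P (insert t (Y - {y}))"
    and c: "c < l" and Y': "singular_subset l Y'" "card Y' = c" "A \<subseteq> Y'"
    and Y: "singular_subset l Y" "card Y = c" "A \<subseteq> Y" "P Y"
  shows "P Y'"
  using Y
proof (induction "card (Y' - Y)" arbitrary: Y rule: less_induct)
  case (less Y)
  note fin = finite_singular_subset[OF less.prems(1)] and fin' = finite_singular_subset[OF Y'(1)]
  have smaller: "card (Y' - insert t (Y - {y})) < card (Y' - Y)"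
    if "t \<in> Y'" "t \<notin> Y" "y \<notin> Y'" for t y
    by (rule psubset_card_mono) (use fin' that in auto)
  have swap: "singular_subset l (insert t (Y - {y})) \<and> card (insert t (Y - {y})) = c
      \<and> A \<subseteq> insert t (Y - {y}) \<and> P (insert t (Y - {y}))"
    if "singular_subset l Y" "card Y = c" "A \<subseteq> Y" "P Y"
      "y \<in> Y" "y \<notin> A" "t \<notin> Y" "singular_subset l (insert t Y)" for t y Y
  proof -
    have "card (insert t (Y - {y})) = card Y"
      using that(5,7) finite_singular_subset[OF that(1)]
      by (metis DiffD1 card.remove card_insert_disjoint finite_Diff)
    moreover have "singular_subset l (insert t (Y - {y}))"
      by (rule singular_subset_mono[OF that(8)]) auto
    ultimately show ?thesis using that step[of Y y t] by auto
  qed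
  show ?case
  proof (cases "Y' \<subseteq> Y")
    case True
    then have "Y' = Y" using card_subset_eq[OF fin] less.prems Y' by simp
    then show ?thesis using less.prems by simp
  next
    case False
    then obtain t where t: "t \<in> Y'" "t \<notin> Y" by blast
    have tl: "t \<in> signed_indices l" using t Y' unfolding singular_subset_def by blast
    show ?thesis
    proof (cases "- t \<in> Y")
      case False
      have "\<not> Y \<subseteq> Y'" using card_subset_eq[OF fin'] less.prems Y' t by metis
      then obtain y where y: "y \<in> Y" "y \<notin> Y'" by blast
      then have "y \<notin> A" using Y' by blast
      then show ?thesis
        using swap[OF less.prems y(1) _ t(2) singular_subset_insert[OF less.prems(1) tl False]]
          less.hyps[OF smaller[OF t y(2)]] by blast
    next
      case True
      have tY': "- t \<notin> Y'" using t Y' unfolding singular_subset_def by blast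
      then have tA: "- t \<notin> A" using Y' by blast
      obtain s where s: "s \<in> signed_indices l" "s \<notin> Y" "- s \<notin> Y"
        using singular_subset_fresh[OF less.prems(1)] less.prems c by blast
      let ?Y1 = "insert s (Y - {- t})"
      note Y1 = swap[OF less.prems True tA s(2) singular_subset_insert[OF less.prems(1) s(1,3)]]
      have st: "s \<noteq> - t" "s \<noteq> t" using s True by auto
      have "- t \<notin> ?Y1" "t \<notin> ?Y1" "s \<notin> A" using st t s less.prems by auto
      moreover have "insert t (?Y1 - {s}) = insert t (Y - {- t})" using s by auto
      ultimately have "singular_subset l (insert t (Y - {- t})) \<and> card (insert t (Y - {- t})) = c
          \<and> A \<subseteq> insert t (Y - {- t}) \<and> P (insert t (Y - {- t}))"
        using swap[of ?Y1 s t] Y1 singular_subset_insert[of l ?Y1 t] tl by simp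
      then show ?thesis using less.hyps[OF smaller[OF t tY']] by blast
    qed
  qed
qed

section \<open>Embeddings of polar Johnson graphs\<close>

locale johnson_embedding = ranked_polar_space +
  fixes k l m :: nat and f :: "int set \<Rightarrow> 'a set"
  assumes m_pos: "0 < m" and l_ge: "m + 3 \<le> l"
    and embedding: "graph_embedding (PJ_vertices l m) (PJ_adjacent l m)
           (grassmannian G (int k)) (grassmann_adjacent G (int k)) f"
    and tops: "\<forall>T\<in>PJ_tops l m. independent_set (grassmann_space G (int k)) (f ` T) \<and>
           (\<exists>T'\<in>grassmann_tops G (int k). f ` T \<subseteq> T')"
begin

abbreviation "V \<equiv> PJ_vertices l m"

lemma vertexI: "singular_subset l X \<Longrightarrow> card X = m + 1 \<Longrightarrow> X \<in> V"
  unfolding PJ_vertices_def by simp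

lemma vertexD:
  assumes "X \<in> V"
  shows "singular_subset l X" "card X = m + 1" "finite X"
  using assms finite_singular_subset unfolding PJ_vertices_def by auto

lemma f_grassmannian: "X \<in> V \<Longrightarrow> f X \<in> grassmannian G (int k)"
  using embedding unfolding graph_embedding_def by blast

lemmas fD = grassmannianD[OF f_grassmannian]

lemma f_eq_iff: "X \<in> V \<Longrightarrow> Y \<in> V \<Longrightarrow> f X = f Y \<longleftrightarrow> X = Y"
  using embedding unfolding graph_embedding_def inj_on_def by blast

lemma f_adjacent_iff:
  "X \<in> V \<Longrightarrow> Y \<in> V \<Longrightarrow> grassmann_adjacent G (int k) (f X) (f Y) \<longleftrightarrow> PJ_adjacent l m X Y"
  using embedding unfolding graph_embedding_def by blast

text \<open>The bound on \<open>l\<close> gives \<open>m \<le> l - 2\<close>, which makes the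
  condition on the union unconditional.\<close>

lemma PJ_adjacent_iff:
  assumes "X \<in> V" "Y \<in> V"
  shows "PJ_adjacent l m X Y \<longleftrightarrow> card (X \<inter> Y) = m \<and> singular_subset l (X \<union> Y)"
  using assms l_ge unfolding PJ_adjacent_def by auto

lemma top_subspace:
  assumes Y: "singular_subset l Y" "card Y = m + 2"
  obtains U where "U \<in> grassmannian G (int k + 1)"
    and "f ` {X. X \<subseteq> Y \<and> card X = m + 1} \<subseteq> subspaces_below G (int k) U"
    and "independent_set (grassmann_space G (int k)) (f ` {X. X \<subseteq> Y \<and> card X = m + 1})"
proof -
  have "{X. X \<subseteq> Y \<and> card X = m + 1} \<in> PJ_tops l m" unfolding PJ_tops_def using Y by blast
  from tops[rule_format, OF this] show ?thesis using that unfolding grassmann_tops_def by blast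
qed

text \<open>Distinct hyperplanes of \<open>U\<close> meet in codimension one and all points of
  \<open>U\<close> are collinear; the embedding then reflects adjacency. It serves to refute that
  images of non-adjacent vertices share such a \<open>U\<close>.\<close>

lemma adjacent_of_common_top:
  assumes X: "X \<in> V" and Y: "Y \<in> V" and "X \<noteq> Y"
    and U: "U \<in> grassmannian G (int k + 1)" "f X \<subseteq> U" "f Y \<subseteq> U"
  shows "PJ_adjacent l m X Y"
proof -
  have "\<not> f X \<subseteq> f Y"
    using assms f_eq_iff grassmannian_subset_eq[OF f_grassmannian f_grassmannian] by blast
  then have "has_dim G (f X \<inter> f Y) (int k - 1)"
    using hyperplane_Int[OF grassmannianD(1,2)[OF U(1)] fD(2,3)[OF Y] U(3) fD(2,3)[OF X] U(2)] by simp
  moreover have "\<forall>p\<in>f X. \<forall>q\<in>f Y. collinear G p q"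
    using singular_subspaceD(2)[OF grassmannianD(1)[OF U(1)]] U by blast
  ultimately have "grassmann_adjacent G (int k) (f X) (f Y)"
    unfolding grassmann_adjacent_def using f_grassmannian X Y by simp
  then show ?thesis using f_adjacent_iff X Y by simp
qed

text \<open>With \<open>A\<close>, \<open>B\<close>, \<open>C\<close> the images of \<open>Z\<close> extended by \<open>i\<close>, \<open>j\<close>, \<open>t\<close>: if \<open>C\<close> does not contain
  \<open>A \<inter> B\<close>, then \<open>C\<close> lies in the span of \<open>A\<close> and \<open>B\<close>, hence is adjacent to the image of
  \<open>Z \<union> {i, j} - {z}\<close> for \<open>z \<in> Z\<close>, although the two vertices are not adjacent.
  This is where \<open>m > 0\<close> is used.\<close>

lemma star_Int_subset:
  assumes S: "singular_subset l (insert i (insert j (insert t Z)))" and Z: "card Z = m"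
    and ne: "i \<noteq> j" "i \<noteq> t" "j \<noteq> t" and notin: "i \<notin> Z" "j \<notin> Z" "t \<notin> Z"
  shows "f (insert i Z) \<inter> f (insert j Z) \<subseteq> f (insert t Z)"
proof (rule ccontr)
  assume not: "\<not> ?thesis"
  let ?A = "f (insert i Z)" and ?B = "f (insert j Z)" and ?C = "f (insert t Z)"
  have finZ: "finite Z" using finite_singular_subset[OF S] by simp
  have sing: "singular_subset l X" if "X \<subseteq> insert i (insert j (insert t Z))" for X
    using singular_subset_mono[OF S that] .
  have V: "insert x Z \<in> V" if "x \<in> {i, j, t}" for x
  proof (rule vertexI)
    show "singular_subset l (insert x Z)" by (rule sing) (use that in auto)
    show "card (insert x Z) = m + 1" using that finZ notin Z by auto
  qed
  have vA: "insert i Z \<in> V" and vB: "insert j Z \<in> V" and vC: "insert t Z \<in> V" using V by auto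
  have adj: "has_dim G (f (insert x Z) \<inter> f (insert y Z)) (int k - 1)"
    if "x \<in> {i, j, t}" "y \<in> {i, j, t}" "x \<noteq> y" for x y
  proof -
    have "singular_subset l (insert x Z \<union> insert y Z)" by (rule sing) (use that in auto)
    moreover have "insert x Z \<inter> insert y Z = Z" using that notin by auto
    ultimately have "PJ_adjacent l m (insert x Z) (insert y Z)"
      using PJ_adjacent_iff V that Z by simp
    then show ?thesis using f_adjacent_iff V that unfolding grassmann_adjacent_def by blast
  qed
  have AC: "has_dim G (?A \<inter> ?C) (int k - 1)" and BC: "has_dim G (?B \<inter> ?C) (int k - 1)"
    and AB: "has_dim G (?A \<inter> ?B) (int k - 1)" using adj ne by auto
  have sub: "is_subspace G (f (insert x Z) \<inter> f (insert y Z))" if "x \<in> {i, j, t}" "y \<in> {i, j, t}" for x y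
    using is_subspace_Int fD(3) V that by blast
  have sAC: "is_subspace G (?A \<inter> ?C)" and sBC: "is_subspace G (?B \<inter> ?C)"
    and sAB: "is_subspace G (?A \<inter> ?B)" using sub by auto
  have grAC: "?A \<inter> ?C \<in> grassmannian G (int k - 1)" and grBC: "?B \<inter> ?C \<in> grassmannian G (int k - 1)"
    and grAB: "?A \<inter> ?B \<in> grassmannian G (int k - 1)"
    using grassmannian_subspace[OF f_grassmannian[OF vA] sAC _ AC]
      grassmannian_subspace[OF f_grassmannian[OF vB] sBC _ BC]
      grassmannian_subspace[OF f_grassmannian[OF vA] sAB _ AB] by auto
  \<comment> \<open>By equality of dimensions the inclusion would give
    \<open>?A \<inter> ?C = ?A \<inter> ?B\<close>, inside \<open>?C\<close>. The resulting
    \<open>p\<close>, together with \<open>?B \<inter> ?C\<close>, spans \<open>?C\<close> within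
    \<open>U\<close>.\<close>
  have "\<not> ?A \<inter> ?C \<subseteq> ?B"
  proof
    assume "?A \<inter> ?C \<subseteq> ?B"
    then have "?A \<inter> ?C = ?A \<inter> ?B" using grassmannian_subset_eq[OF grAC grAB] by blast
    then show False using not by blast
  qed
  then obtain p where p: "p \<in> ?A" "p \<in> ?C" "p \<notin> ?B" by blast
  let ?Y = "insert i (insert j Z)"
  have Y: "singular_subset l ?Y" by (rule sing) auto
  have "card ?Y = m + 2" using finZ notin ne Z by simp
  from top_subspace[OF Y this] obtain U where U: "U \<in> grassmannian G (int k + 1)"
    and UX: "f ` {X. X \<subseteq> ?Y \<and> card X = m + 1} \<subseteq> subspaces_below G (int k) U" by blast
  have below: "f X \<subseteq> U" if "X \<subseteq> ?Y" "card X = m + 1" for X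
    using UX that unfolding subspaces_below_def by blast
  have AU: "?A \<subseteq> U" by (rule below) (use finZ notin Z in auto)
  have BU: "?B \<subseteq> U" by (rule below) (use finZ notin Z in auto)
  have "spanned G (insert p (?B \<inter> ?C)) = ?C"
    by (rule hyperplane_join[of _ "int k - 1"]) (use fD[OF vC] BC sBC p in auto)
  moreover have "spanned G (insert p (?B \<inter> ?C)) \<subseteq> U"
    by (rule spanned_minimal[OF grassmannianD(3)[OF U]]) (use p AU BU in auto)
  ultimately have CU: "?C \<subseteq> U" by simp
  obtain z where z: "z \<in> Z" using m_pos Z by fastforce
  let ?X = "?Y - {z}"
  have cX: "card ?X = m + 1" using finZ notin ne Z z by auto
  have vX: "?X \<in> V" by (rule vertexI) (use sing[of ?X] cX in auto)
  have "?X \<inter> insert t Z = Z - {z}" using ne notin by auto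
  then have "card (?X \<inter> insert t Z) = m - 1" using z finZ Z by simp
  then have "card (?X \<inter> insert t Z) \<noteq> m" using m_pos by simp
  then have nadj: "\<not> PJ_adjacent l m ?X (insert t Z)" unfolding PJ_adjacent_def by blast
  have "?X \<noteq> insert t Z" using z by blast
  moreover have "f ?X \<subseteq> U" by (rule below) (use cX in auto)
  ultimately show False using adjacent_of_common_top[OF vX vC _ U _ CU] nadj by blast
qed

section \<open>The subspaces attached to singular sets\<close>

definition W :: "int set \<Rightarrow> 'a set" where
  "W A = \<Inter>(f ` {X \<in> V. A \<subseteq> X})"

lemma W_subset: "X \<in> V \<Longrightarrow> A \<subseteq> X \<Longrightarrow> W A \<subseteq> f X"
  unfolding W_def by blast

lemma W_mono: "A \<subseteq> B \<Longrightarrow> W A \<subseteq> W B"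
  unfolding W_def by blast

lemma W_vertex:
  assumes "X \<in> V"
  shows "W X = f X"
proof -
  have "Y = X" if "Y \<in> V" "X \<subseteq> Y" for Y
    using card_subset_eq[of Y X] that vertexD[OF assms] vertexD[OF that(1)] by simp
  then have "{Y \<in> V. X \<subseteq> Y} = {X}" using assms by blast
  then show ?thesis unfolding W_def by simp
qed

lemma W_eq:
  assumes Y: "singular_subset l Y" "card Y = m + 2" "A \<subseteq> Y"
  shows "W A = \<Inter>(f ` {X. A \<subseteq> X \<and> X \<subseteq> Y \<and> card X = m + 1})" (is "_ = ?D")
proof
  show "W A \<subseteq> ?D"
    unfolding W_def by (rule Inter_anti_mono) (use Y singular_subset_mono vertexI in blast)
  have *: "?D \<subseteq> f X" if X: "X \<in> V" "A \<subseteq> X" for X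
  proof -
    obtain Y' where Y': "singular_subset l Y'" "X \<subseteq> Y'" "card Y' = m + 2"
      using singular_subset_extend[OF vertexD(1)[OF X(1)], of "m + 2"] vertexD(2)[OF X(1)] l_ge by auto
    \<comment> \<open>\<open>?D\<close> stays the intersection for the original \<open>Y\<close>
      while the index set moves to \<open>Y'\<close>.\<close>
    have "\<forall>X. A \<subseteq> X \<and> X \<subseteq> Y' \<and> card X = m + 1 \<longrightarrow> ?D \<subseteq> f X"
    proof (rule singular_subset_connected[where Y = Y and c = "m + 2" and l = l and A = A
          and P = "\<lambda>Y. \<forall>X. A \<subseteq> X \<and> X \<subseteq> Y \<and> card X = m + 1 \<longrightarrow> ?D \<subseteq> f X"])
      fix Y y t
      assume P: "\<forall>X. A \<subseteq> X \<and> X \<subseteq> Y \<and> card X = m + 1 \<longrightarrow> ?D \<subseteq> f X"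
        and Y: "singular_subset l Y" "card Y = m + 2" "A \<subseteq> Y" and y: "y \<in> Y" "y \<notin> A"
        and t: "t \<notin> Y" "singular_subset l (insert t Y)"
      have finY: "finite Y" using finite_singular_subset[OF Y(1)] .
      show "\<forall>X. A \<subseteq> X \<and> X \<subseteq> insert t (Y - {y}) \<and> card X = m + 1 \<longrightarrow> ?D \<subseteq> f X"
      proof (intro allI impI, elim conjE)
        fix X assume X: "A \<subseteq> X" "X \<subseteq> insert t (Y - {y})" "card X = m + 1"
        show "?D \<subseteq> f X"
        proof (cases "t \<in> X")
          case False
          then have "X \<subseteq> Y" using X by blast
          then show ?thesis using P X by blast
        next
          case True
          \<comment> \<open>\<open>?Z\<close> has \<open>m\<close> of the \<open>m + 1\<close>
            elements of \<open>Y - {y}\<close>, so some \<open>i\<close> is left over. The vertices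
            extending \<open>?Z\<close> by \<open>i\<close> and by \<open>y\<close> both lie in the
            old \<open>Y\<close>, and the triangle argument passes from their images to that of
            \<open>X\<close>.\<close>
          let ?Z = "X - {t}"
          have finX: "finite X" using X(2) finY finite_subset by blast
          have Z: "?Z \<subseteq> Y - {y}" "card ?Z = m" "A \<subseteq> ?Z" "insert t ?Z = X"
            using X True Y t finX by auto
          have "card (Y - {y}) = m + 1" using Y y finY by simp
          then have "?Z \<noteq> Y - {y}" using Z by auto
          then obtain i where i: "i \<in> Y" "i \<noteq> y" "i \<notin> ?Z" using Z by blast
          have finZ: "finite ?Z" using finX by simp
          have yZ: "y \<notin> ?Z" using Z by blast
          have "f (insert i ?Z) \<inter> f (insert y ?Z) \<subseteq> f (insert t ?Z)"
          proof (rule star_Int_subset)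
            show "singular_subset l (insert i (insert y (insert t ?Z)))"
              by (rule singular_subset_mono[OF t(2)]) (use i y Z in auto)
          qed (use Z i y t yZ in auto)
          moreover have "?D \<subseteq> f (insert x ?Z)" if "x \<in> Y" "x \<notin> ?Z" for x
          proof -
            have "card (insert x ?Z) = m + 1" using that(2) finZ Z(2) by simp
            moreover have "A \<subseteq> insert x ?Z" "insert x ?Z \<subseteq> Y" using Z that by auto
            ultimately show ?thesis using P by blast
          qed
          ultimately have "?D \<subseteq> f (insert t ?Z)" using i y yZ by blast
          then show ?thesis using Z(4) by simp
        qed
      qed
    next
      show "\<forall>X. A \<subseteq> X \<and> X \<subseteq> Y \<and> card X = m + 1 \<longrightarrow> ?D \<subseteq> f X" by blast
    qed (use Y Y' X l_ge in auto)
    then show ?thesis using X Y' vertexD(2)[OF X(1)] by blast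
  qed
  show "?D \<subseteq> W A" unfolding W_def by (rule Inter_greatest) (use * in auto)
qed

text \<open>The vertices in \<open>W_eq\<close> are the sets \<open>Y - {y}\<close> with
  \<open>y\<close> in \<open>Y - A\<close>: \<open>m + 2 - card A\<close> independent hyperplanes of
  a \<open>(k + 1)\<close>-dimensional \<open>U\<close>. The bound on \<open>card A\<close> leaves
  at least one; beyond it no vertex contains \<open>A\<close> and \<open>W A\<close> is
  \<open>UNIV\<close>.\<close>

lemma W_grassmannian:
  assumes A: "singular_subset l A" "card A \<le> m + 1"
  shows "W A \<in> grassmannian G (int k - int m - 1 + int (card A))"
proof -
  obtain Y where Y: "singular_subset l Y" "A \<subseteq> Y" "card Y = m + 2"
    using singular_subset_extend[OF A(1), of "m + 2"] A(2) l_ge by auto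
  have finY: "finite Y" using finite_singular_subset[OF Y(1)] .
  obtain U where U: "U \<in> grassmannian G (int k + 1)"
    and below: "f ` {X. X \<subseteq> Y \<and> card X = m + 1} \<subseteq> subspaces_below G (int k) U"
    and ind: "independent_set (grassmann_space G (int k)) (f ` {X. X \<subseteq> Y \<and> card X = m + 1})"
    using top_subspace[OF Y(1,3)] .
  let ?S = "{X. A \<subseteq> X \<and> X \<subseteq> Y \<and> card X = m + 1}"
  have S: "?S = (\<lambda>y. Y - {y}) ` (Y - A)"
  proof
    show "?S \<subseteq> (\<lambda>y. Y - {y}) ` (Y - A)"
    proof
      fix X assume X: "X \<in> ?S"
      then have "card (Y - X) = 1" using card_Diff_subset[of X Y] finY Y finite_subset[of X Y] by auto
      then obtain y where "Y - X = {y}" using card_1_singletonE by blast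
      then have "X = Y - {y}" "y \<in> Y - A" using X by auto
      then show "X \<in> (\<lambda>y. Y - {y}) ` (Y - A)" by blast
    qed
    show "(\<lambda>y. Y - {y}) ` (Y - A) \<subseteq> ?S" using Y finY by auto
  qed
  have "inj_on (\<lambda>y. Y - {y}) (Y - A)" by (rule inj_onI) blast
  then have "card ?S = card (Y - A)" unfolding S by (rule card_image)
  also have "\<dots> = m + 2 - card A"
    using card_Diff_subset[of A Y] Y finY finite_subset[of A Y] by simp
  finally have cS: "card ?S = m + 2 - card A" .
  have SV: "?S \<subseteq> V" using vertexI[OF singular_subset_mono[OF Y(1)]] by blast
  have "inj_on f V" using embedding unfolding graph_embedding_def by simp
  then have "inj_on f ?S" using SV by (rule inj_on_subset)
  then have cfS: "card (f ` ?S) = m + 2 - card A" using cS by (simp only: card_image)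
  have "\<Inter>(f ` ?S) \<in> grassmannian G (int k + 1 - int (card (f ` ?S)))"
  proof (rule independent_Inter_dim[OF U below ind])
    have "card ?S > 0" using cS A(2) by simp
    then show "finite (f ` ?S)" "f ` ?S \<noteq> {}" unfolding card_gt_0_iff by simp_all
    show "f ` ?S \<subseteq> f ` {X. X \<subseteq> Y \<and> card X = m + 1}" by blast
  qed
  moreover have "int k + 1 - int (card (f ` ?S)) = int k - int m - 1 + int (card A)"
    using cfS A(2) by simp
  ultimately show ?thesis using W_eq[OF Y(1,3,2)] by (simp only:)
qed

lemmas WD = grassmannianD[OF W_grassmannian]

text \<open>The only vertex inside \<open>Y\<close> that avoids \<open>x\<close> is
  \<open>Y - {x}\<close>, which contains \<open>A\<close>. So the inclusion would put
  \<open>W {x}\<close> below all images of vertices in \<open>Y\<close>, hence into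
  \<open>W {}\<close>, against the dimensions.\<close>

lemma W_not_subset:
  assumes A: "singular_subset l (insert x A)" "x \<notin> A" "card A \<le> m"
  shows "\<not> W {x} \<subseteq> W A"
proof
  assume *: "W {x} \<subseteq> W A"
  have finA: "finite A" using finite_singular_subset[OF A(1)] by simp
  then obtain Y where Y: "singular_subset l Y" "insert x A \<subseteq> Y" "card Y = m + 2"
    using singular_subset_extend[OF A(1), of "m + 2"] A l_ge by auto
  have finY: "finite Y" using finite_singular_subset[OF Y(1)] .
  have "W {x} \<subseteq> f X" if X: "X \<subseteq> Y" "card X = m + 1" for X
  proof -
    have v: "X \<in> V" using singular_subset_mono[OF Y(1) X(1)] X vertexI by blast
    show ?thesis
    proof (cases "x \<in> X")
      case True
      then show ?thesis using W_subset[OF v] by simp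
    next
      case False
      then have "X \<subseteq> Y - {x}" using X by blast
      moreover have "card (Y - {x}) = card X" using X Y finY by simp
      ultimately have "X = Y - {x}" using card_subset_eq[of "Y - {x}" X] finY by simp
      then have "A \<subseteq> X" using Y A(2) by blast
      then show ?thesis using * W_subset[OF v] by blast
    qed
  qed
  then have "W {x} \<subseteq> W {}" using W_eq[OF Y(1,3), of "{}"] by auto
  then have eq: "W {x} = W {}" using W_mono[of "{}" "{x}"] by blast
  have "singular_subset l {x}" by (rule singular_subset_mono[OF A(1)]) simp
  then have 1: "has_dim G (W {x}) (int k - int m - 1 + 1)" "singular_subspace G (W {x})"
    using WD(1,2)[of "{x}"] by simp_all
  have "singular_subset l {}" by (rule singular_subset_mono[OF A(1)]) simp
  then have "has_dim G (W {}) (int k - int m - 1)" using WD(2)[of "{}"] by simp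
  then show False using has_dim_unique[OF 1(2) 1(1)] eq by fastforce
qed

text \<open>\<open>W A\<close> is a hyperplane of \<open>W (insert x A)\<close>, and
  \<open>W {x}\<close> has a point off it.\<close>

lemma W_insert:
  assumes A: "singular_subset l (insert x A)" "x \<notin> A" "card A \<le> m"
  shows "spanned G (W A \<union> W {x}) = W (insert x A)"
proof -
  obtain p where p: "p \<in> W {x}" "p \<notin> W A" using W_not_subset[OF A] by blast
  have finA: "finite A" using finite_singular_subset[OF A(1)] by simp
  have sA: "singular_subset l A" by (rule singular_subset_mono[OF A(1)]) blast
  have c: "card (insert x A) \<le> m + 1" "int (card (insert x A)) = int (card A) + 1"
    using A(2,3) finA by auto
  have sub: "W A \<subseteq> W (insert x A)" "W {x} \<subseteq> W (insert x A)" by (auto intro!: W_mono)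
  have cA: "card A \<le> m + 1" using A(3) by simp
  have dI: "has_dim G (W (insert x A)) (int k - int m - 1 + int (card A) + 1)"
    using WD(2)[OF A(1) c(1)] c(2) by (simp add: algebra_simps)
  have "spanned G (insert p (W A)) = W (insert x A)"
    using hyperplane_join[OF WD(1)[OF A(1) c(1)] dI WD(2)[OF sA cA] WD(3)[OF sA cA] sub(1), of p]
      p sub by blast
  moreover have "spanned G (insert p (W A)) \<subseteq> spanned G (W A \<union> W {x})"
    by (rule spanned_mono) (use p in blast)
  moreover have "spanned G (W A \<union> W {x}) \<subseteq> W (insert x A)"
    by (rule spanned_minimal[OF WD(3)[OF A(1) c(1)]]) (use sub in blast)
  ultimately show ?thesis by blast
qed

text \<open>The induction starts at singletons: the empty union spans only the empty set, whereas
  \<open>W {}\<close> has dimension \<open>k - m - 1\<close>.\<close>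

lemma W_eq_spanned:
  assumes "finite A" "A \<noteq> {}" "singular_subset l A" "card A \<le> m + 1"
  shows "W A = spanned G (\<Union>x\<in>A. W {x})"
  using assms
proof (induction A rule: finite_ne_induct)
  case (singleton x)
  then show ?case using spanned_subspace[OF WD(3)[of "{x}"]] by simp
next
  case (insert x A)
  let ?S = "spanned G (\<Union>y\<in>insert x A. W {y})"
  have sA: "singular_subset l A" by (rule singular_subset_mono[OF insert.prems(1)]) blast
  have cA: "card A \<le> m" using insert by simp
  have ins: "W (insert x A) = spanned G (W A \<union> W {x})"
    using W_insert[OF insert.prems(1) insert.hyps(3) cA] by simp
  have sub: "is_subspace G (W (insert x A))" using WD(3)[OF insert.prems] .
  have gen: "(\<Union>y\<in>insert x A. W {y}) \<subseteq> W (insert x A)"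
    using W_mono[of "{_}" "insert x A"] by blast
  have "W A = spanned G (\<Union>y\<in>A. W {y})" using insert.IH[OF sA] cA by simp
  also have "\<dots> \<subseteq> ?S" by (rule spanned_mono) blast
  finally have "W A \<subseteq> ?S" .
  moreover have "W {x} \<subseteq> ?S" using subset_spanned[of "\<Union>y\<in>insert x A. W {y}" G] by blast
  moreover have "is_subspace G ?S" using is_subspace_spanned[OF sub gen] .
  ultimately have "spanned G (W A \<union> W {x}) \<subseteq> ?S" using spanned_minimal[of G ?S] by simp
  moreover have "?S \<subseteq> W (insert x A)" using spanned_minimal[OF sub gen] .
  ultimately show ?case using ins by blast
qed

text \<open>Orthogonality would spread to \<open>f X\<close> and \<open>f X'\<close>, where
  \<open>X\<close> and \<open>X'\<close> extend an \<open>m\<close>-set \<open>Z\<close> by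
  \<open>x\<close> and \<open>- x\<close>. These images are distinct and share \<open>W Z\<close>,
  of dimension \<open>k - m - 1 + m = k - 1\<close>, so they would be adjacent, although
  \<open>X \<union> X'\<close> is not singular.\<close>

lemma W_opposite_not_orthogonal:
  assumes x: "x \<in> signed_indices l"
  shows "\<exists>p\<in>W {x}. \<exists>q\<in>W {- x}. \<not> collinear G p q"
proof (rule ccontr)
  assume "\<not> ?thesis"
  then have orth: "\<forall>p\<in>W {x}. \<forall>q\<in>W {- x}. collinear G p q" by blast
  have x0: "x \<noteq> 0" using x unfolding signed_indices_def by simp
  have mx: "- x \<in> signed_indices l" using x unfolding signed_indices_def by simp
  have "singular_subset l {x}" using singular_subset_insert[of l "{}" x] x unfolding singular_subset_def by simp
  then obtain X where X: "singular_subset l X" "{x} \<subseteq> X" "card X = m + 1"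
    using singular_subset_extend[of l "{x}" "m + 1"] l_ge by auto
  have finX: "finite X" using finite_singular_subset[OF X(1)] .
  define Z where "Z = X - {x}"
  have Z: "insert x Z = X" "x \<notin> Z" "- x \<notin> Z" "card Z = m" "finite Z"
    using X finX unfolding Z_def singular_subset_def by auto
  have sZ: "singular_subset l Z" by (rule singular_subset_mono[OF X(1)]) (use Z in blast)
  define X' where "X' = insert (- x) Z"
  have sX': "singular_subset l X'"
    unfolding X'_def by (rule singular_subset_insert[OF sZ mx]) (use Z in simp)
  have cX': "card X' = m + 1" unfolding X'_def using Z by simp
  have vX: "X \<in> V" and vX': "X' \<in> V" using vertexI X sX' cX' by auto
  have "x \<in> X'" if "X = X'" using that X by blast
  then have \<X>': "X \<noteq> X'" using Z(2) x0 unfolding X'_def by auto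
  have fne: "f X \<noteq> f X'" using f_eq_iff[OF vX vX'] \<X>' by simp
  have "\<not> singular_subset l (X \<union> X')" using X(2) unfolding X'_def singular_subset_def by blast
  then have nadj: "\<not> grassmann_adjacent G (int k) (f X) (f X')"
    using f_adjacent_iff[OF vX vX'] PJ_adjacent_iff[OF vX vX'] by simp
  have fX: "f X = spanned G (W Z \<union> W {x})"
    using W_insert[of x Z] Z X(1) W_vertex[OF vX] by simp
  have fX': "f X' = spanned G (W Z \<union> W {- x})"
    using W_insert[of "- x" Z] Z sX' W_vertex[OF vX'] unfolding X'_def by simp
  have gX: "W Z \<subseteq> f X" "W {x} \<subseteq> f X" and gX': "W Z \<subseteq> f X'" "W {- x} \<subseteq> f X'"
    using fX fX' subset_spanned by (metis Un_subset_iff)+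
  have pts: "f X \<subseteq> points G" "f X' \<subseteq> points G"
    using fD(3)[OF vX] fD(3)[OF vX'] unfolding is_subspace_def by auto
  have sym: "collinear G p q \<longleftrightarrow> collinear G q p" for p q unfolding collinear_def by auto
  have span_perp: "\<forall>q\<in>spanned G (A \<union> B). collinear G p q"
    if "p \<in> points G" "A \<union> B \<subseteq> points G" "\<forall>q\<in>A. collinear G p q" "\<forall>q\<in>B. collinear G p q" for p A B
  proof -
    have "spanned G (A \<union> B) \<subseteq> {q \<in> points G. collinear G p q}"
      by (rule spanned_minimal[OF is_subspace_perp[OF that(1)]]) (use that in auto)
    then show ?thesis by blast
  qed
  \<comment> \<open>The points collinear with one fixed point form a subspace, so only one argument
    can be extended at a time: first over \<open>f X'\<close> with \<open>p\<close> in
    \<open>W {x}\<close> fixed, then over \<open>f X\<close> with \<open>q\<close> in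
    \<open>f X'\<close> fixed.\<close>
  have perp_x: "\<forall>q\<in>f X'. collinear G p q" if p: "p \<in> W {x}" for p
    unfolding fX'
  proof (rule span_perp)
    show "p \<in> points G" using p gX pts by blast
    show "W Z \<union> W {- x} \<subseteq> points G" using gX' pts by blast
    show "\<forall>q\<in>W Z. collinear G p q" using singular_subspaceD(2)[OF fD(1)[OF vX]] p gX by blast
    show "\<forall>q\<in>W {- x}. collinear G p q" using orth p by blast
  qed
  have perp: "\<forall>p\<in>f X. collinear G q p" if q: "q \<in> f X'" for q
    unfolding fX
  proof (rule span_perp)
    show "q \<in> points G" using q pts by blast
    show "W Z \<union> W {x} \<subseteq> points G" using gX pts by blast
    show "\<forall>p\<in>W Z. collinear G q p" using singular_subspaceD(2)[OF fD(1)[OF vX'] q] gX' by blast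
    show "\<forall>p\<in>W {x}. collinear G q p" using perp_x q sym by blast
  qed
  have sI: "is_subspace G (f X \<inter> f X')" using is_subspace_Int fD(3) vX vX' by blast
  have "f X \<inter> f X' \<noteq> f X"
    using grassmannian_subset_eq[OF f_grassmannian[OF vX] f_grassmannian[OF vX']] fne by blast
  then obtain d where d: "has_dim G (f X \<inter> f X') d" "d < int k"
    using has_dim_subspace[OF fD(1,2)[OF vX] sI] by blast
  have sing: "singular_subspace G (f X \<inter> f X')"
    using singular_subspace_subset[OF fD(1)[OF vX] sI] by blast
  have cZ: "card Z \<le> m + 1" using Z by simp
  obtain e where e: "has_dim G (W Z) e" "e \<le> d"
    by (rule has_dim_subspace[OF sing d(1) WD(3)[OF sZ cZ]]) (use gX(1) gX'(1) in auto)
  have "e = int k - int m - 1 + int (card Z)"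
    using has_dim_unique[OF WD(1)[OF sZ cZ] e(1) WD(2)[OF sZ cZ]] .
  then have "d = int k - 1" using Z(4) d(2) e(2) by simp
  then have "grassmann_adjacent G (int k) (f X) (f X')"
    unfolding grassmann_adjacent_def using d(1) f_grassmannian[OF vX] f_grassmannian[OF vX'] perp sym by blast
  then show False using nadj by blast
qed

section \<open>The frame in the residue of \<open>W {}\<close>\<close>

abbreviation "R \<equiv> residue G (int k - int m) (W {})"

lemma singular_singleton: "x \<in> signed_indices l \<Longrightarrow> singular_subset l {x}"
  using singular_subset_insert[of l "{}" x] unfolding singular_subset_def by simp

lemma W_empty: "W {} \<in> grassmannian G (int k - int m - 1)"
  using W_grassmannian[of "{}"] unfolding singular_subset_def by simp

lemma W_singleton: "x \<in> signed_indices l \<Longrightarrow> W {x} \<in> grassmannian G (int k - int m)"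
  using W_grassmannian[of "{x}"] singular_singleton by simp

text \<open>The residue line between \<open>W {}\<close> and \<open>W {y, x}\<close> joins them;
  \<open>m > 0\<close> makes a two-element set small enough for the dimension formula.\<close>

lemma W_collinear:
  assumes "x \<in> signed_indices l" "y \<in> signed_indices l" "y \<noteq> x" "y \<noteq> - x"
  shows "collinear R (W {x}) (W {y})"
proof -
  have "singular_subset l {y, x}"
    using singular_subset_insert[OF singular_singleton[OF assms(1)] assms(2)] assms(4) by auto
  then have "W {y, x} \<in> grassmannian G (int k - int m + 1)"
    using W_grassmannian[of "{y, x}"] assms(3) m_pos by (simp add: add.commute)
  moreover have "W {} \<subseteq> W {y, x}" by (rule W_mono) simp
  ultimately have "subspaces_between G (int k - int m) (W {}) (W {y, x}) \<in> lines R"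
    unfolding residue_def using W_empty by auto
  moreover have "W {z} \<in> subspaces_between G (int k - int m) (W {}) (W {y, x})" if "z \<in> {y, x}" for z
    unfolding subspaces_between_def using W_singleton assms that W_mono by auto
  ultimately show ?thesis unfolding collinear_def by blast
qed

text \<open>Whether equal or on a common line of the residue, both would lie in one singular
  subspace and so be orthogonal.\<close>

lemma W_opposite_not_collinear:
  assumes x: "x \<in> signed_indices l"
  shows "\<not> collinear R (W {x}) (W {- x})"
proof
  assume "collinear R (W {x}) (W {- x})"
  then consider "W {x} = W {- x}" | U d where "U \<in> grassmannian G d" "W {x} \<subseteq> U" "W {- x} \<subseteq> U"
    unfolding collinear_def residue_def subspaces_between_def by auto
  then obtain U d where "U \<in> grassmannian G d" "W {x} \<subseteq> U" "W {- x} \<subseteq> U"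
    using W_singleton[OF x] by (metis order_refl)
  then show False
    using W_opposite_not_orthogonal[OF x] singular_subspaceD(2)[OF grassmannianD(1)[of U G d]] by blast
qed

text \<open>Collinearity is reflexive, which separates opposite indices; for the others
  \<open>W_not_subset\<close> suffices.\<close>

lemma W_inj: "inj_on (\<lambda>x. W {x}) (signed_indices l)"
proof (rule inj_onI, rule ccontr)
  fix x y assume xy: "x \<in> signed_indices l" "y \<in> signed_indices l" "W {x} = W {y}" "x \<noteq> y"
  show False
  proof (cases "y = - x")
    case True
    then show ?thesis using W_opposite_not_collinear[OF xy(1)] xy(3) unfolding collinear_def by simp
  next
    case False
    then have "singular_subset l {x, y}"
      using singular_subset_insert[OF singular_singleton[OF xy(2)] xy(1)] by auto
    then show ?thesis using W_not_subset[of x "{y}"] xy m_pos by auto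
  qed
qed

lemma W_frame: "frame R l ((\<lambda>x. W {x}) ` signed_indices l)"
  unfolding frame_def
proof (intro conjI)
  show "(\<lambda>x. W {x}) ` signed_indices l \<subseteq> points R"
    unfolding residue_def subspaces_above_def using W_singleton W_mono by auto
  show "finite ((\<lambda>x. W {x}) ` signed_indices l)" using finite_signed_indices by simp
  show "card ((\<lambda>x. W {x}) ` signed_indices l) = 2 * l"
    using card_image[OF W_inj] card_signed_indices by simp
  show "\<forall>p\<in>(\<lambda>x. W {x}) ` signed_indices l.
    \<exists>!q. q \<in> (\<lambda>x. W {x}) ` signed_indices l \<and> q \<noteq> p \<and> \<not> collinear R p q"
  proof
    fix p assume "p \<in> (\<lambda>x. W {x}) ` signed_indices l"
    then obtain x where x: "x \<in> signed_indices l" "p = W {x}" by blast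
    have mx: "- x \<in> signed_indices l" using x unfolding signed_indices_def by simp
    note nc = W_opposite_not_collinear[OF x(1)]
    then have "W {- x} \<noteq> W {x}" unfolding collinear_def by auto
    moreover have "q = W {- x}"
      if "q \<in> (\<lambda>x. W {x}) ` signed_indices l" "q \<noteq> p" "\<not> collinear R p q" for q
      using that W_collinear[OF x(1)] x(2) by blast
    ultimately show "\<exists>!q. q \<in> (\<lambda>x. W {x}) ` signed_indices l \<and> q \<noteq> p \<and> \<not> collinear R p q"
      using nc mx x(2) by blast
  qed
qed

end

theorem theorem4p4:
  fixes \<Pi> :: "'p geometry" and n k l m :: nat and f :: "int set \<Rightarrow> 'p set"
  assumes "polar_space_of_rank \<Pi> n" and "n \<ge> 3"
    and "0 < m" and "m \<le> k" and "l \<le> n"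
    and "3 \<le> int l - int m" and "int l - int m \<le> int n - int k"
    and "graph_embedding (PJ_vertices l m) (PJ_adjacent l m)
           (grassmannian \<Pi> (int k)) (grassmann_adjacent \<Pi> (int k)) f"
    and "\<forall>T\<in>PJ_tops l m. independent_set (grassmann_space \<Pi> (int k)) (f ` T) \<and>
           (\<exists>T'\<in>grassmann_tops \<Pi> (int k). f ` T \<subseteq> T')"
  shows "\<exists>N\<in>grassmannian \<Pi> (int k - int m - 1).
           f ` PJ_vertices l m \<subseteq> subspaces_above \<Pi> (int k) N \<and>
           (\<exists>\<B>. frame (residue \<Pi> (int k - int m) N) l \<B> \<and>
             (\<forall>X\<in>f ` PJ_vertices l m. \<exists>\<A>\<subseteq>\<B>. X = spanned \<Pi> (\<Union>\<A>)))"
proof -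
  interpret johnson_embedding \<Pi> n k l m f
    by unfold_locales (use assms in auto)
  show ?thesis
  proof (intro bexI[OF _ W_empty] conjI exI[of _ "(\<lambda>x. W {x}) ` signed_indices l"])
    show "f ` PJ_vertices l m \<subseteq> subspaces_above \<Pi> (int k) (W {})"
      unfolding subspaces_above_def using f_grassmannian W_subset by auto
    show "frame (residue \<Pi> (int k - int m) (W {})) l ((\<lambda>x. W {x}) ` signed_indices l)"
      by (rule W_frame)
    show "\<forall>P\<in>f ` PJ_vertices l m. \<exists>\<A>\<subseteq>(\<lambda>x. W {x}) ` signed_indices l. P = spanned \<Pi> (\<Union>\<A>)"
    proof
      fix P assume "P \<in> f ` PJ_vertices l m"
      then obtain X where X: "X \<in> PJ_vertices l m" "P = f X" by blast
      have "X \<noteq> {}" using vertexD(2)[OF X(1)] by auto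
      then have "P = spanned \<Pi> (\<Union>x\<in>X. W {x})"
        using W_eq_spanned[of X] vertexD[OF X(1)] W_vertex[OF X(1)] X(2) by simp
      moreover have "X \<subseteq> signed_indices l" using vertexD(1)[OF X(1)] unfolding singular_subset_def by blast
      ultimately show "\<exists>\<A>\<subseteq>(\<lambda>x. W {x}) ` signed_indices l. P = spanned \<Pi> (\<Union>\<A>)"
        using image_mono[of X "signed_indices l" "\<lambda>x. W {x}"] by blast
    qed
  qed
qed

end
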